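(* Let $F$ be a free group of rank $3$. There exists a faithful transitive action $F\curvearrowright X$ such that $\mathcal T(F\curvearrowright X)=6$ and the restrictions of the action to finite index subgroups of $F$ have arbitrarily large Tarski numbers; that is, for every $N\in\mathbb N$ there is a finite index subgroup $F_0\le F$ such that $\mathcal T(F_0\curvearrowright X)\ge N$.
   Context: All groups act from the right. A group action $G\curvearrowright X$ admits a paradoxical decomposition if there exist positive integers $m,n$, (pairwise) disjoint subsets $P_1,\dots,P_m,Q_1,\dots,Q_n$ of $X$ and subsets $S_1=\{g_1,\dots,g_m\}$, $S_2=\{h_1,\dots,h_n\}$ of $G$ such that $X=\bigcup_{i=1}^m P_ig_i=\bigcup_{j=1}^n Q_jh_j$. The Tarski number $\mathcal T(G\curvearrowright X)$ is the minimal possible value of $m+n$ over all paradoxical decompositions of the action (and $\infty$ if there is none). For $F_0\le F$, $F_0\curvearrowright X$ denotes the restriction of the action to $F_0$. *)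

theory Defs
  imports "HOL-Algebra.Group_Action" "HOL-Library.Disjoint_Sets" "HOL-Library.Extended_Nat"
begin

section \<open>Free groups\<close>

text \<open>
  A word over \<open>B\<close> is a list of signed letters; \<open>(b, True)\<close> stands for \<open>b\<close> and
  \<open>(b, False)\<close> for the inverse of \<open>b\<close>.
\<close>

definition reduced_words :: "'a set \<Rightarrow> ('a \<times> bool) list set" where
  "reduced_words B =
     {w. set w \<subseteq> B \<times> UNIV \<and>
         successively (\<lambda>(a, s) (b, t). \<not> (a = b \<and> s \<noteq> t)) w}"

definition letter_value :: "('a, 'c) monoid_scheme \<Rightarrow> 'a \<times> bool \<Rightarrow> 'a" where
  "letter_value G = (\<lambda>(b, s). if s then b else inv\<^bsub>G\<^esub> b)"

definition word_value :: "('a, 'c) monoid_scheme \<Rightarrow> ('a \<times> bool) list \<Rightarrow> 'a" where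
  "word_value G w = foldr (\<lambda>l x. letter_value G l \<otimes>\<^bsub>G\<^esub> x) w \<one>\<^bsub>G\<^esub>"

text \<open>
  \<open>B\<close> is a free basis if every element has a unique expression as a reduced word over \<open>B\<close>.
\<close>

definition free_basis :: "('a, 'c) monoid_scheme \<Rightarrow> 'a set \<Rightarrow> bool" where
  "free_basis G B \<longleftrightarrow>
     B \<subseteq> carrier G \<and> bij_betw (word_value G) (reduced_words B) (carrier G)"

definition free_group_of_rank :: "('a, 'c) monoid_scheme \<Rightarrow> nat \<Rightarrow> bool" where
  "free_group_of_rank G r \<longleftrightarrow>
     group G \<and> (\<exists>B. free_basis G B \<and> finite B \<and> card B = r)"

section \<open>Right actions\<close>

text \<open>
  The actions of \<^theory>\<open>HOL-Algebra.Group_Action\<close> are left actions. A right action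
  of \<open>G\<close>, written \<open>x g = \<phi> g x\<close>, is a left action of the opposite group.
\<close>

definition opposite :: "('a, 'c) monoid_scheme \<Rightarrow> ('a, 'c) monoid_scheme" where
  "opposite G = G\<lparr>mult := \<lambda>x y. y \<otimes>\<^bsub>G\<^esub> x\<rparr>"

lemma opposite_simps [simp]:
  "carrier (opposite G) = carrier G"
  "\<one>\<^bsub>opposite G\<^esub> = \<one>\<^bsub>G\<^esub>"
  "x \<otimes>\<^bsub>opposite G\<^esub> y = y \<otimes>\<^bsub>G\<^esub> x"
  by (simp_all add: opposite_def)

lemma group_opposite:
  assumes "group G"
  shows "group (opposite G)"
proof -
  interpret group G by fact
  show ?thesis
    by (rule groupI) (auto simp: m_assoc intro: r_inv_ex)
qed

lemma right_action_one:
  assumes "group_action (opposite G) \<Omega> \<phi>" "x \<in> \<Omega>"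
  shows "\<phi> \<one>\<^bsub>G\<^esub> x = x"
  using group_action.id_eq_one[OF assms(1)] assms(2)
  by (metis opposite_simps(2) restrict_apply')

lemma right_action_mult:
  assumes "group_action (opposite G) \<Omega> \<phi>" "x \<in> \<Omega>" "g \<in> carrier G" "h \<in> carrier G"
  shows "\<phi> (g \<otimes>\<^bsub>G\<^esub> h) x = \<phi> h (\<phi> g x)"
  using group_action.composition_rule[OF assms(1), of x h g] assms by simp

section \<open>Paradoxical decompositions and Tarski numbers\<close>

definition paradoxical_decomposition ::
    "('a, 'c) monoid_scheme \<Rightarrow> 'x set \<Rightarrow> ('a \<Rightarrow> 'x \<Rightarrow> 'x) \<Rightarrow> nat \<Rightarrow> nat \<Rightarrow>
     (nat \<Rightarrow> 'x set) \<Rightarrow> (nat \<Rightarrow> 'x set) \<Rightarrow> (nat \<Rightarrow> 'a) \<Rightarrow> (nat \<Rightarrow> 'a) \<Rightarrow> bool" where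
  "paradoxical_decomposition G \<Omega> \<phi> m n P Q g h \<longleftrightarrow>
     m > 0 \<and> n > 0 \<and>
     (\<forall>i<m. P i \<subseteq> \<Omega> \<and> g i \<in> carrier G) \<and>
     (\<forall>j<n. Q j \<subseteq> \<Omega> \<and> h j \<in> carrier G) \<and>
     disjoint_family_on P {..<m} \<and>
     disjoint_family_on Q {..<n} \<and>
     (\<forall>i<m. \<forall>j<n. P i \<inter> Q j = {}) \<and>
     \<Omega> = (\<Union>i<m. \<phi> (g i) ` P i) \<and>
     \<Omega> = (\<Union>j<n. \<phi> (h j) ` Q j)"

text \<open>
  The infimum of the empty set in \<^typ>\<open>enat\<close> is \<open>\<infinity>\<close>, and the infimum of a nonempty set
  is its minimum.
\<close>

definition tarski_number ::
    "('a, 'c) monoid_scheme \<Rightarrow> 'x set \<Rightarrow> ('a \<Rightarrow> 'x \<Rightarrow> 'x) \<Rightarrow> enat" where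
  "tarski_number G \<Omega> \<phi> =
     Inf {enat (m + n) | m n. \<exists>P Q g h. paradoxical_decomposition G \<Omega> \<phi> m n P Q g h}"

end

theory Submission
  imports Defs "HOL-Algebra.Generated_Groups" "HOL-Library.Countable_Set"
begin

text \<open>
  A right action of the free group \<open>F\<close> on \<open>X\<close> is read as a graph: the vertices are the points of \<open>X\<close>,
  and each basis element \<open>b\<close> gives an edge from \<open>x\<close> to \<open>x b\<close>. Two properties of this graph control
  Tarski numbers from opposite sides.

  Few edges give a paradoxical decomposition. Call the action sparse if every finite set \<open>Z\<close> of vertices
  spans at most \<open>3/2 |Z|\<close> edges. Let \<open>a, b, c\<close> be the basis, let a first copy of each point \<open>x\<close> choose
  among \<open>x, x a, x b\<close> and a second copy among \<open>x, x a, x c\<close>. If \<open>A\<close> and \<open>C\<close> are finite sets of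
  first and second copies, then the points that they may choose span at least
  \<open>|A \<union> C| + |A| + |C| \<ge> 3/2 (|A| + |C|)\<close> edges, so there are at least \<open>|A| + |C|\<close> of them. Hall's
  marriage theorem then yields a paradoxical decomposition with \<open>3 + 3\<close> pieces.

  Fixed points prevent decompositions. If all translating elements fix a common point, then that point
  lies in some \<open>P\<^sub>i\<close> and in some \<open>Q\<^sub>j\<close>. Hence, if any \<open>k\<close> elements of a subgroup have a common fixed
  point, the Tarski number of that subgroup is larger than \<open>k\<close>. A variant excludes \<open>2 + 3\<close> pieces for
  the whole group: if \<open>X = P\<^sub>0 g\<^sub>0 \<union> P\<^sub>1 g\<^sub>1\<close>, then every point with a finite orbit under
  \<open>g\<^sub>0 g\<^sub>1\<^sup>-\<^sup>1\<close> lies in \<open>P\<^sub>0 \<union> P\<^sub>1\<close>, so a contradiction arises from a point \<open>x\<close> for which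
  all \<open>x h\<^sub>j\<^sup>-\<^sup>1\<close> have finite orbits. A common fixed point of the at most three elements
  \<open>h\<^sub>j\<^sup>-\<^sup>1 (g\<^sub>0 g\<^sub>1\<^sup>-\<^sup>1)\<^sup>L h\<^sub>j\<close> is such a point, and for suitable \<open>L > 0\<close> these elements lie in any
  given normal subgroup of finite index.

  It remains to build a faithful transitive sparse action in which, for every \<open>k\<close>, any \<open>k\<close> elements of a
  suitable normal subgroup \<open>K\<^sub>k\<close> of finite index have a common fixed point. Residual finiteness
  (\<open>residually_finite\<close>) provides \<open>K\<^sub>k\<close> without nontrivial elements of length at most \<open>2 k + 2\<close>. If
  \<open>H \<le> K\<^sub>k\<close> is generated by \<open>k\<close> elements, the coset graph of \<open>H\<close> has no short cycles, and a set of
  \<open>n\<close> vertices spans at most \<open>n + k\<close> edges, as its cycles are detected by the homomorphisms from \<open>H\<close> to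
  \<open>\<int>/2\<close>; together this makes the graph strictly sparse (\<open>coset_action_strictly_sparse\<close>). Finally, all
  these coset graphs are attached to a single Cayley graph of \<open>F\<close>, by exchanging the ends of one edge of
  the Cayley graph and one edge of the coset graph outside the finite part that matters
  (\<open>glue_along_free_orbit\<close>). The orbit of a vertex of the Cayley graph is the desired action
  (\<open>sparse_action_with_fixed_points\<close>).
\<close>

section \<open>Marriages in infinite families\<close>

text \<open>
  This is Rado's proof. Among the sets of pairs \<open>(i, x)\<close> that may be removed from the relation
  \<open>x \<in> N i\<close> without destroying the marriage condition, take a maximal one by Zorn's lemma. Then only one
  candidate is left for each \<open>i\<close>: if neither of two candidates \<open>x, y\<close> could be removed, there would be
  two sets \<open>J, K\<close> of indices blocking these removals, and counting the candidates of
  \<open>J \<union> K \<union> {i}\<close> and of \<open>J \<inter> K\<close> gives a contradiction.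
\<close>

lemma infinite_marriage:
  fixes N :: "'i \<Rightarrow> 'x set"
  assumes fin: "\<And>i. i \<in> I \<Longrightarrow> finite (N i)"
    and hall: "\<And>J. finite J \<Longrightarrow> J \<subseteq> I \<Longrightarrow> card J \<le> card (\<Union>i\<in>J. N i)"
  shows "\<exists>f. inj_on f I \<and> (\<forall>i\<in>I. f i \<in> N i)"
proof -
  define M where "M T i = N i - T `` {i}" for T i
  define hall_after where
    "hall_after T \<longleftrightarrow> (\<forall>J. finite J \<longrightarrow> J \<subseteq> I \<longrightarrow> card J \<le> card (\<Union>i\<in>J. M T i))" for T
  have finM: "finite (\<Union>i\<in>J. M T i)" if "finite J" "J \<subseteq> I" for J T
    using that fin by (auto simp: M_def)
  have chain: "\<Union>C \<in> Collect hall_after" if C: "subset.chain (Collect hall_after) C" for C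
  proof (cases "C = {}")
    case True
    then show ?thesis using hall by (simp add: hall_after_def M_def)
  next
    case False
    have "card J \<le> card (\<Union>i\<in>J. M (\<Union>C) i)" if J: "finite J" "J \<subseteq> I" for J
    proof -
      \<comment> \<open>The removals that concern \<open>J\<close> are finitely many, so one member of the chain has them all.\<close>
      let ?R = "\<Union>C \<inter> (SIGMA i:J. N i)"
      have "finite ?R"
        using J fin by (meson finite_Int finite_SigmaI subsetD)
      moreover have "?R \<subseteq> \<Union>C" by blast
      moreover have "subset.chain UNIV C"
        using C by (auto simp: subset_chain_def)
      ultimately obtain T where T: "T \<in> C" "?R \<subseteq> T"
        using finite_subset_Union_chain[of ?R C UNIV] False by auto
      have "(\<Union>i\<in>J. M T i) \<subseteq> (\<Union>i\<in>J. M (\<Union>C) i)"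
        using T by (fastforce simp: M_def)
      moreover have "card J \<le> card (\<Union>i\<in>J. M T i)"
        using T C J by (auto simp: subset_chain_def hall_after_def)
      ultimately show ?thesis
        by (meson card_mono finM J order_trans)
    qed
    then show ?thesis by (simp add: hall_after_def)
  qed
  obtain T where T: "hall_after T" and max: "\<And>T'. hall_after T' \<Longrightarrow> T \<subseteq> T' \<Longrightarrow> T' = T"
    using subset_Zorn'[OF chain] by auto
  have ge: "card J \<le> card (\<Union>i\<in>J. M T i)" if "finite J" "J \<subseteq> I" for J
    using T that by (auto simp: hall_after_def)
  \<comment> \<open>By maximality, removing one more candidate violates the condition on some set of
    indices, which has to contain \<open>i\<close>.\<close>
  have blocked: "\<exists>J. finite J \<and> J \<subseteq> I \<and> i \<notin> J \<and> card ((\<Union>j\<in>J. M T j) \<union> (M T i - {x})) \<le> card J"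
    if i: "i \<in> I" and x: "x \<in> M T i" for i x
  proof -
    have "insert (i, x) T \<noteq> T" using x by (auto simp: M_def)
    then have "\<not> hall_after (insert (i, x) T)" using max by blast
    then obtain J where J: "finite J" "J \<subseteq> I"
      and lt: "card (\<Union>j\<in>J. M (insert (i, x) T) j) < card J"
      by (auto simp: hall_after_def not_le)
    have off: "M (insert (i, x) T) j = M T j" if "j \<noteq> i" for j
      using that by (auto simp: M_def)
    have at: "M (insert (i, x) T) i = M T i - {x}"
      by (auto simp: M_def)
    have "i \<in> J"
    proof (rule ccontr)
      assume "i \<notin> J"
      then have "(\<Union>j\<in>J. M (insert (i, x) T) j) = (\<Union>j\<in>J. M T j)"
        using off by (metis (no_types, lifting) SUP_cong)
      with lt ge[OF J] show False by simp
    qed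
    then have "(\<Union>j\<in>J. M (insert (i, x) T) j) = (\<Union>j\<in>J - {i}. M T j) \<union> (M T i - {x})"
      using UN_insert[of "M (insert (i, x) T)" i "J - {i}"] off at
      by (simp add: insert_absorb Un_commute)
    with lt \<open>i \<in> J\<close> J show ?thesis
      by (intro exI[of _ "J - {i}"]) auto
  qed
  have single: "\<exists>x. M T i = {x}" if i: "i \<in> I" for i
  proof -
    have "M T i \<noteq> {}"
      using ge[of "{i}"] i by auto
    moreover have "x = y" if x: "x \<in> M T i" and y: "y \<in> M T i" for x y
    proof (rule ccontr)
      assume "x \<noteq> y"
      obtain J where J: "finite J" "J \<subseteq> I" "i \<notin> J"
        and cJ: "card ((\<Union>j\<in>J. M T j) \<union> (M T i - {x})) \<le> card J" (is "card ?U \<le> _")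
        using blocked[OF i x] by auto
      obtain K where K: "finite K" "K \<subseteq> I" "i \<notin> K"
        and cK: "card ((\<Union>j\<in>K. M T j) \<union> (M T i - {y})) \<le> card K" (is "card ?V \<le> _")
        using blocked[OF i y] by auto
      have fin': "finite ?U" "finite ?V"
        using finM[of J T] finM[of K T] fin[OF i] J K by (auto simp: M_def)
      have "(\<Union>j\<in>insert i (J \<union> K). M T j) \<subseteq> ?U \<union> ?V"
        using \<open>x \<noteq> y\<close> by auto
      then have "card (\<Union>j\<in>insert i (J \<union> K). M T j) \<le> card (?U \<union> ?V)"
        using fin' by (intro card_mono) auto
      moreover have "card (insert i (J \<union> K)) \<le> card (\<Union>j\<in>insert i (J \<union> K). M T j)"
        using i J K by (intro ge) auto
      ultimately have "card (insert i (J \<union> K)) \<le> card (?U \<union> ?V)"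
        by (rule order_trans[rotated])
      moreover have "card (J \<inter> K) \<le> card (?U \<inter> ?V)"
      proof -
        have "(\<Union>j\<in>J \<inter> K. M T j) \<subseteq> ?U \<inter> ?V" by auto
        then show ?thesis
          using ge[of "J \<inter> K"] J fin' by (meson card_mono finite_Int inf.coboundedI1 order_trans)
      qed
      ultimately have "Suc (card (J \<union> K)) + card (J \<inter> K) \<le> card ?U + card ?V"
        using card_Un_Int[OF fin'] J K by simp
      with cJ cK card_Un_Int[OF J(1) K(1)] show False by simp
    qed
    ultimately show ?thesis by (metis ex_in_conv is_singletonI' is_singleton_def)
  qed
  define f where "f i = the_elem (M T i)" for i
  have f: "M T i = {f i}" if "i \<in> I" for i
    using single[OF that] unfolding f_def by (metis the_elem_eq)
  have "inj_on f I"
  proof (rule inj_onI, rule ccontr)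
    fix i j assume ij: "i \<in> I" "j \<in> I" "f i = f j" "i \<noteq> j"
    have "M T i = {f i}" "M T j = {f i}"
      using f[OF ij(1)] f[OF ij(2)] ij(3) by simp_all
    then have "card (\<Union>k\<in>{i, j}. M T k) = 1" by simp
    moreover have "card {i, j} = 2" using ij by simp
    ultimately show False using ge[of "{i, j}"] ij by simp
  qed
  moreover have "\<forall>i\<in>I. f i \<in> N i"
    using f by (fastforce simp: M_def)
  ultimately show ?thesis by blast
qed

section \<open>Words in a free group\<close>

lemma letter_value_closed:
  assumes "group G" "b \<in> carrier G"
  shows "letter_value G (b, s) \<in> carrier G"
  using assms by (simp add: letter_value_def group.inv_closed)

lemma word_value_Nil [simp]: "word_value G [] = \<one>\<^bsub>G\<^esub>"
  by (simp add: word_value_def)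

lemma word_value_Cons [simp]:
  "word_value G (l # w) = letter_value G l \<otimes>\<^bsub>G\<^esub> word_value G w"
  by (simp add: word_value_def)

lemma word_value_closed:
  assumes "group G" "set w \<subseteq> carrier G \<times> UNIV"
  shows "word_value G w \<in> carrier G"
proof -
  interpret group G by fact
  show ?thesis
    using assms(2) by (induction w) (auto intro!: m_closed letter_value_closed[OF assms(1)])
qed

lemma word_value_append:
  assumes "group G" "set u \<subseteq> carrier G \<times> UNIV" "set v \<subseteq> carrier G \<times> UNIV"
  shows "word_value G (u @ v) = word_value G u \<otimes>\<^bsub>G\<^esub> word_value G v"
proof -
  interpret group G by fact
  show ?thesis
    using assms(2)
  proof (induction u)
    case Nil
    then show ?case using word_value_closed[OF assms(1,3)] by simp
  next
    case (Cons l u)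
    then have "letter_value G l \<in> carrier G" "word_value G u \<in> carrier G"
      using letter_value_closed[OF assms(1)] word_value_closed[OF assms(1)] by auto
    then show ?case
      using Cons word_value_closed[OF assms(1,3)] by (simp add: m_assoc)
  qed
qed

lemma word_value_letter:
  assumes "group G" "b \<in> carrier G"
  shows "word_value G [(b, True)] = b"
  using assms by (simp add: letter_value_def monoid.r_one group.is_monoid)

lemma word_value_cancel:
  assumes "group G" "b \<in> carrier G" "set w \<subseteq> carrier G \<times> UNIV"
  shows "word_value G ((b, s) # (b, \<not> s) # w) = word_value G w"
proof -
  interpret group G by fact
  have "word_value G w \<in> carrier G" by (rule word_value_closed[OF assms(1,3)])
  then show ?thesis
    using assms(2) by (cases s) (simp_all add: letter_value_def m_assoc[symmetric])
qed

abbreviation rename_word :: "('a \<Rightarrow> 'b) \<Rightarrow> ('a \<times> bool) list \<Rightarrow> ('b \<times> bool) list" where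
  "rename_word f \<equiv> map (\<lambda>(b, s). (f b, s))"

lemma reduced_words_subset: "w \<in> reduced_words B \<Longrightarrow> set w \<subseteq> B \<times> UNIV"
  by (simp add: reduced_words_def)

text \<open>
  Cancelling a pair of inverse letters changes neither the value in \<open>F\<close> nor the value of the renamed
  word in \<open>G\<close>. Tracking both values at once is what makes the homomorphism of \<open>free_basis_hom\<close> well
  defined.
\<close>

lemma reduced_word_exists:
  assumes F: "group F" "B \<subseteq> carrier F" and G: "group G" "f \<in> B \<rightarrow> carrier G"
    and w: "set w \<subseteq> B \<times> UNIV"
  shows "\<exists>v\<in>reduced_words B. word_value F v = word_value F w \<and>
           word_value G (rename_word f v) = word_value G (rename_word f w)"
  using w
proof (induction w)
  case Nil
  then show ?case by (intro bexI[of _ "[]"]) (auto simp: reduced_words_def)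
next
  case (Cons l w)
  obtain b s where l: "l = (b, s)" "b \<in> B"
    using Cons.prems by (cases l) auto
  obtain v where v: "v \<in> reduced_words B" "word_value F v = word_value F w"
    "word_value G (rename_word f v) = word_value G (rename_word f w)"
    using Cons by auto
  have vB: "set v \<subseteq> B \<times> UNIV" using reduced_words_subset v by blast
  have vF: "set v \<subseteq> carrier F \<times> UNIV" and vG: "set (rename_word f v) \<subseteq> carrier G \<times> UNIV"
    using vB F G by auto
  show ?case
  proof (cases "\<exists>v'. v = (b, \<not> s) # v'")
    case True
    then obtain v' where v': "v = (b, \<not> s) # v'" by auto
    have "v' \<in> reduced_words B"
      using v(1) v' by (auto simp: reduced_words_def successively_Cons)
    moreover have "word_value F (l # v) = word_value F v'"
      using word_value_cancel[OF F(1), of b v' s] l F vF v' by auto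
    moreover have "word_value G (rename_word f (l # v)) = word_value G (rename_word f v')"
      using word_value_cancel[OF G(1), of "f b" "rename_word f v'" s] l G(2) vG v' by auto
    ultimately show ?thesis
      using v v' l by (intro bexI[of _ v']) auto
  next
    case False
    then have "l # v \<in> reduced_words B"
      using v(1) l by (cases v) (auto simp: reduced_words_def)
    then show ?thesis
      using v l by (intro bexI[of _ "l # v"]) auto
  qed
qed

text \<open>
  The universal property of free groups.
\<close>

lemma free_basis_hom:
  assumes F: "group F" "free_basis F B" and G: "group G" "f \<in> B \<rightarrow> carrier G"
  shows "\<exists>h\<in>hom F G. \<forall>b\<in>B. h b = f b"
proof -
  have B: "B \<subseteq> carrier F" and bij: "bij_betw (word_value F) (reduced_words B) (carrier F)"
    using F(2) by (auto simp: free_basis_def)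
  define h where
    "h g = word_value G (rename_word f (inv_into (reduced_words B) (word_value F) g))" for g
  have h: "h (word_value F w) = word_value G (rename_word f w)" if w: "set w \<subseteq> B \<times> UNIV" for w
  proof -
    obtain v where v: "v \<in> reduced_words B" "word_value F v = word_value F w"
      "word_value G (rename_word f v) = word_value G (rename_word f w)"
      using reduced_word_exists[OF F(1) B G w] by auto
    then show ?thesis
      unfolding h_def using bij by (metis bij_betw_imp_inj_on inv_into_f_f)
  qed
  have word: "\<exists>w. set w \<subseteq> B \<times> UNIV \<and> word_value F w = g" if "g \<in> carrier F" for g
    using bij that reduced_words_subset unfolding bij_betw_def by (metis imageE)
  have ren: "set (rename_word f w) \<subseteq> carrier G \<times> UNIV" if "set w \<subseteq> B \<times> UNIV" for w
    using that G(2) by auto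
  have "h \<in> hom F G"
  proof (rule homI)
    fix x assume "x \<in> carrier F"
    then show "h x \<in> carrier G"
      using word h ren word_value_closed[OF G(1)] by metis
  next
    fix x y assume "x \<in> carrier F" "y \<in> carrier F"
    then obtain u v where u: "set u \<subseteq> B \<times> UNIV" "word_value F u = x"
      and v: "set v \<subseteq> B \<times> UNIV" "word_value F v = y"
      using word by meson
    have "x \<otimes>\<^bsub>F\<^esub> y = word_value F (u @ v)"
      using word_value_append[OF F(1), of u v] u v Sigma_mono[OF B order_refl] by (metis order_trans)
    then have "h (x \<otimes>\<^bsub>F\<^esub> y) = word_value G (rename_word f (u @ v))"
      using h[of "u @ v"] u v by simp
    also have "\<dots> = h x \<otimes>\<^bsub>G\<^esub> h y"
      using word_value_append[OF G(1) ren[OF u(1)] ren[OF v(1)]] h[OF u(1)] h[OF v(1)] u v by simp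
    finally show "h (x \<otimes>\<^bsub>F\<^esub> y) = h x \<otimes>\<^bsub>G\<^esub> h y" .
  qed
  moreover have "h b = f b" if "b \<in> B" for b
  proof -
    have "word_value F [(b, True)] = b"
      using that B word_value_letter[OF F(1)] by blast
    moreover have "word_value G [(f b, True)] = f b"
      using that G(2) word_value_letter[OF G(1)] by blast
    ultimately show ?thesis
      using h[of "[(b, True)]"] that by simp
  qed
  ultimately show ?thesis by blast
qed

locale finite_free_basis = group G for G (structure) +
  fixes B
  assumes basis: "free_basis G B" and finite_basis: "finite B"
begin

lemma basis_closed: "b \<in> B \<Longrightarrow> b \<in> carrier G"
  using basis by (auto simp: free_basis_def)

lemma words_closed: "set w \<subseteq> B \<times> UNIV \<Longrightarrow> set w \<subseteq> carrier G \<times> UNIV"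
  using basis_closed by auto

lemma word_closed: "set w \<subseteq> B \<times> UNIV \<Longrightarrow> word_value G w \<in> carrier G"
  using word_value_closed[OF is_group words_closed] .

lemma letter_closed: "b \<in> B \<Longrightarrow> letter_value G (b, s) \<in> carrier G"
  using letter_value_closed[OF is_group basis_closed] .

lemma word_exists: "g \<in> carrier G \<Longrightarrow> \<exists>w\<in>reduced_words B. word_value G w = g"
  using basis unfolding free_basis_def bij_betw_def by (metis imageE)

lemma reduced_word_inj:
  "u \<in> reduced_words B \<Longrightarrow> v \<in> reduced_words B \<Longrightarrow> word_value G u = word_value G v \<Longrightarrow> u = v"
  using basis by (auto simp: free_basis_def bij_betw_def inj_on_def)

lemma reduced_word_one:
  assumes "w \<in> reduced_words B" "word_value G w = \<one>"
  shows "w = []"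
  using reduced_word_inj[OF assms(1), of "[]"] assms(2) by (simp add: reduced_words_def)

lemma word_append:
  "set u \<subseteq> B \<times> UNIV \<Longrightarrow> set v \<subseteq> B \<times> UNIV \<Longrightarrow>
     word_value G (u @ v) = word_value G u \<otimes> word_value G v"
  using word_value_append[OF is_group words_closed words_closed] .

lemma basis_induct [consumes 1, case_names one pos neg]:
  assumes g: "g \<in> carrier G"
    and one: "P \<one>"
    and pos: "\<And>b g. b \<in> B \<Longrightarrow> g \<in> carrier G \<Longrightarrow> P g \<Longrightarrow> P (b \<otimes> g)"
    and neg: "\<And>b g. b \<in> B \<Longrightarrow> g \<in> carrier G \<Longrightarrow> P g \<Longrightarrow> P (inv b \<otimes> g)"
  shows "P g"
proof -
  obtain w where w: "w \<in> reduced_words B" "word_value G w = g"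
    using word_exists[OF g] by auto
  have "set w \<subseteq> B \<times> UNIV" using reduced_words_subset[OF w(1)] .
  then have "P (word_value G w)"
  proof (induction w)
    case Nil
    then show ?case using one by simp
  next
    case (Cons l w)
    obtain b s where l: "l = (b, s)" "b \<in> B" using Cons.prems by (cases l) auto
    have "P (word_value G w)" "word_value G w \<in> carrier G"
      using Cons word_closed by auto
    then show ?case
      using pos[OF l(2)] neg[OF l(2)] l by (cases s) (simp_all add: letter_value_def)
  qed
  then show ?thesis using w by simp
qed

end

section \<open>Right actions of free groups\<close>

text \<open>
  This locale hides the opposite group behind the usual laws of a right action.
\<close>

locale right_action = group G for G (structure) +
  fixes S and \<phi>
  assumes action: "group_action (opposite G) S \<phi>"
begin

lemma act_closed: "g \<in> carrier G \<Longrightarrow> x \<in> S \<Longrightarrow> \<phi> g x \<in> S"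
  using group_action.element_image[OF action, of g x] by simp

lemma act_one: "x \<in> S \<Longrightarrow> \<phi> \<one> x = x"
  using right_action_one[OF action] .

lemma act_mult: "g \<in> carrier G \<Longrightarrow> h \<in> carrier G \<Longrightarrow> x \<in> S \<Longrightarrow> \<phi> (g \<otimes> h) x = \<phi> h (\<phi> g x)"
  using right_action_mult[OF action] .

lemma act_inv_act: "g \<in> carrier G \<Longrightarrow> x \<in> S \<Longrightarrow> \<phi> (inv g) (\<phi> g x) = x"
  by (metis act_mult act_one inv_closed r_inv)

lemma act_act_inv: "g \<in> carrier G \<Longrightarrow> x \<in> S \<Longrightarrow> \<phi> g (\<phi> (inv g) x) = x"
  by (metis act_mult act_one inv_closed l_inv)

lemma act_inj: "g \<in> carrier G \<Longrightarrow> x \<in> S \<Longrightarrow> y \<in> S \<Longrightarrow> \<phi> g x = \<phi> g y \<Longrightarrow> x = y"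
  by (metis act_inv_act)

end

text \<open>
  \<open>BijGroup\<close> consists of extensional functions, hence the restriction to \<open>S\<close>.
\<close>

lemma right_action_restrict:
  assumes "group G"
    and closed: "\<And>g x. g \<in> carrier G \<Longrightarrow> x \<in> S \<Longrightarrow> \<psi> g x \<in> S"
    and one: "\<And>x. x \<in> S \<Longrightarrow> \<psi> \<one>\<^bsub>G\<^esub> x = x"
    and mult: "\<And>g h x. g \<in> carrier G \<Longrightarrow> h \<in> carrier G \<Longrightarrow> x \<in> S \<Longrightarrow> \<psi> (g \<otimes>\<^bsub>G\<^esub> h) x = \<psi> h (\<psi> g x)"
  shows "right_action G S (\<lambda>g. restrict (\<psi> g) S)"
proof -
  interpret group G by fact
  have "restrict (\<psi> g) S \<in> Bij S" if g: "g \<in> carrier G" for g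
  proof -
    have "bij_betw (\<psi> g) S S"
    proof (rule bij_betwI[where g = "\<psi> (inv\<^bsub>G\<^esub> g)"])
      show "\<psi> g \<in> S \<rightarrow> S" "\<psi> (inv\<^bsub>G\<^esub> g) \<in> S \<rightarrow> S" using closed g by auto
      show "\<psi> (inv\<^bsub>G\<^esub> g) (\<psi> g x) = x" if "x \<in> S" for x
        using mult[of g "inv\<^bsub>G\<^esub> g" x] g that one by simp
      show "\<psi> g (\<psi> (inv\<^bsub>G\<^esub> g) x) = x" if "x \<in> S" for x
        using mult[of "inv\<^bsub>G\<^esub> g" g x] g that one by simp
    qed
    then show ?thesis by (simp add: Bij_def cong: bij_betw_cong)
  qed
  moreover have "restrict (\<psi> (g \<otimes>\<^bsub>G\<^esub> h)) S = compose S (restrict (\<psi> h) S) (restrict (\<psi> g) S)"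
    if "g \<in> carrier G" "h \<in> carrier G" for g h
    using that mult closed by (auto simp: compose_def restrict_def)
  ultimately have "(\<lambda>g. restrict (\<psi> g) S) \<in> hom (opposite G) (BijGroup S)"
    by (intro homI) (auto simp: BijGroup_def)
  then show ?thesis
    using group_opposite[OF assms(1)] group_BijGroup
    by (auto intro!: right_action.intro right_action_axioms.intro group_action.intro
        group_hom.intro group_hom_axioms.intro assms(1))
qed

text \<open>
  A free group acts by any choice of permutations for its basis elements. The double covers, the finite
  actions for residual finiteness and the glued action below arise in this way.
\<close>

lemma free_basis_action:
  assumes F: "group F" "free_basis F B" and \<sigma>: "\<And>b. b \<in> B \<Longrightarrow> bij_betw (\<sigma> b) S S"
  shows "\<exists>\<phi>. right_action F S \<phi> \<and> (\<forall>b\<in>B. \<forall>x\<in>S. \<phi> b x = \<sigma> b x)"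
proof -
  have "(\<lambda>b. restrict (\<sigma> b) S) \<in> B \<rightarrow> carrier (opposite (BijGroup S))"
    using \<sigma> by (auto simp: BijGroup_def Bij_def cong: bij_betw_cong)
  from free_basis_hom[OF F group_opposite[OF group_BijGroup] this]
  obtain h where h: "h \<in> hom F (opposite (BijGroup S))" "\<forall>b\<in>B. h b = restrict (\<sigma> b) S"
    by auto
  have "h \<in> hom (opposite F) (BijGroup S)"
    using h(1) by (auto simp: hom_def)
  then have "right_action F S h"
    using F(1) group_opposite[OF F(1)] group_BijGroup
    by (auto intro!: right_action.intro right_action_axioms.intro group_action.intro
        group_hom.intro group_hom_axioms.intro)
  with h(2) show ?thesis by auto
qed

section \<open>Edges spanned by finite sets of vertices\<close>

definition inner_edges :: "('a \<Rightarrow> 'x \<Rightarrow> 'x) \<Rightarrow> 'a set \<Rightarrow> 'x set \<Rightarrow> ('x \<times> 'a) set" where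
  "inner_edges \<phi> B Z = {(x, b). x \<in> Z \<and> b \<in> B \<and> \<phi> b x \<in> Z}"

lemma finite_inner_edges: "finite Z \<Longrightarrow> finite B \<Longrightarrow> finite (inner_edges \<phi> B Z)"
  by (rule finite_subset[of _ "Z \<times> B"]) (auto simp: inner_edges_def)

locale free_group_action = finite_free_basis G B + right_action G S \<phi>
  for G (structure) and B S \<phi>
begin

abbreviation edges where "edges \<equiv> inner_edges \<phi> B"

abbreviation step where "step l x \<equiv> \<phi> (letter_value G l) x"

lemma act_word_Cons:
  assumes "b \<in> B" "set w \<subseteq> B \<times> UNIV" "x \<in> S"
  shows "\<phi> (word_value G ((b, s) # w)) x = \<phi> (word_value G w) (step (b, s) x)"
  using assms act_mult letter_closed word_closed by simp

lemma act_word_path: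
  assumes "\<And>i. l i \<in> B \<times> UNIV" "\<And>i. z i \<in> S" "\<And>i. z (Suc i) = step (l i) (z i)"
  shows "\<phi> (word_value G (map l [i..<i + d])) (z i) = z (i + d)"
proof (induction d arbitrary: i)
  case 0
  then show ?case using act_one assms(2) by simp
next
  case (Suc d)
  have "set (map l [Suc i..<Suc i + d]) \<subseteq> B \<times> UNIV"
    using assms(1) unfolding set_map by blast
  moreover have "map l [i..<i + Suc d] = l i # map l [Suc i..<Suc i + d]"
    by (simp add: upt_conv_Cons del: upt_Suc)
  ultimately show ?case
    using act_word_Cons[of "fst (l i)" _ "z i" "snd (l i)"] assms Suc[of "Suc i"]
    by (simp add: mem_Times_iff)
qed

text \<open>
  With at least two letters leading back into \<open>Z\<close> at every vertex, one can walk inside \<open>Z\<close> for ever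
  without backtracking. Some vertex is repeated within the first \<open>card Z\<close> steps.
\<close>

lemma closed_reduced_walk_min_degree:
  assumes Z: "finite Z" "Z \<noteq> {}" "Z \<subseteq> S"
    and deg: "\<And>z. z \<in> Z \<Longrightarrow> 2 \<le> card {l \<in> B \<times> UNIV. step l z \<in> Z}"
  shows "\<exists>z\<in>Z. \<exists>w\<in>reduced_words B. w \<noteq> [] \<and> length w \<le> card Z \<and> \<phi> (word_value G w) z = z"
proof -
  define L where "L z = {l \<in> B \<times> UNIV. step l z \<in> Z}" for z
  have two: "\<exists>l\<in>L z. l \<noteq> k" if "z \<in> Z" for z k
  proof (rule ccontr)
    assume "\<not> ?thesis"
    then have "L z \<subseteq> {k}" by auto
    then have "card (L z) \<le> 1" using card_mono[of "{k}" "L z"] by simp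
    with deg[OF that] show False by (simp add: L_def)
  qed
  \<comment> \<open>A state of the walk is a vertex with the letter to be read next; \<open>Q\<close> forbids that this letter
    undoes the previous one.\<close>
  define Q where
    "Q p q \<longleftrightarrow> fst q = step (snd p) (fst p) \<and> snd q \<noteq> (fst (snd p), \<not> snd (snd p))"
    for p q :: "'c \<times> 'a \<times> bool"
  have "\<exists>s. \<forall>n::nat. (fst (s n) \<in> Z \<and> snd (s n) \<in> L (fst (s n))) \<and> Q (s n) (s (Suc n))"
  proof (rule dependent_nat_choice)
    obtain z where "z \<in> Z" using Z by auto
    then obtain l where "l \<in> L z" using two by blast
    then show "\<exists>x. fst x \<in> Z \<and> snd x \<in> L (fst x)"
      using \<open>z \<in> Z\<close> by (intro exI[of _ "(z, l)"]) simp
  next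
    fix p :: "'c \<times> 'a \<times> bool" and n :: nat
    assume p: "fst p \<in> Z \<and> snd p \<in> L (fst p)"
    then have z: "step (snd p) (fst p) \<in> Z" by (auto simp: L_def)
    obtain l where "l \<in> L (step (snd p) (fst p))" "l \<noteq> (fst (snd p), \<not> snd (snd p))"
      using two[OF z] by blast
    then show "\<exists>q. (fst q \<in> Z \<and> snd q \<in> L (fst q)) \<and> Q p q"
      using z by (intro exI[of _ "(step (snd p) (fst p), l)"]) (simp add: Q_def)
  qed
  then obtain s where s: "\<And>n::nat. fst (s n) \<in> Z" "\<And>n. snd (s n) \<in> L (fst (s n))"
    "\<And>n. Q (s n) (s (Suc n))" by blast
  define z where "z n = fst (s n)" for n
  define l where "l n = snd (s n)" for n
  have z: "z n \<in> Z" "z n \<in> S" and l: "l n \<in> B \<times> UNIV" and nxt: "z (Suc n) = step (l n) (z n)"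
    and red: "l (Suc n) \<noteq> (fst (l n), \<not> snd (l n))" for n
    using s(1)[of n] s(2)[of n] s(3)[of n] Z(3) unfolding z_def l_def Q_def L_def
    by (auto simp: mem_Times_iff)
  have "\<not> inj_on z {..card Z}"
  proof
    assume "inj_on z {..card Z}"
    then have "card {..card Z} \<le> card Z"
      using card_inj_on_le[of z "{..card Z}" Z] z Z(1) by auto
    then show False by simp
  qed
  then obtain i j where ij: "i < j" "j \<le> card Z" "z i = z j"
    unfolding inj_on_def by (metis atMost_iff nat_neq_iff)
  define w where "w = map l [i..<i + (j - i)]"
  have "successively (\<lambda>(a, s) (b, t). \<not> (a = b \<and> s \<noteq> t)) w"
    using red by (auto simp: w_def successively_conv_nth split_beta prod_eq_iff)
  moreover have "set w \<subseteq> B \<times> UNIV"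
    using l unfolding w_def set_map by blast
  ultimately have "w \<in> reduced_words B"
    by (simp add: reduced_words_def)
  moreover have "\<phi> (word_value G w) (z i) = z i"
    unfolding w_def using act_word_path[of l z i "j - i"] l z nxt ij by simp
  moreover have "w \<noteq> []" "length w \<le> card Z"
    using ij by (auto simp: w_def)
  ultimately show ?thesis using z by blast
qed

text \<open>
  A finite graph with at least as many edges as vertices is not a forest. Vertices of degree at most
  one are removed together with their edge until none is left; this keeps the inequality.
\<close>

lemma closed_reduced_walk:
  assumes "finite Z" "Z \<noteq> {}" "Z \<subseteq> S" "card Z \<le> card (edges Z)"
  shows "\<exists>z\<in>Z. \<exists>w\<in>reduced_words B. w \<noteq> [] \<and> length w \<le> card Z \<and> \<phi> (word_value G w) z = z"
  using assms
proof (induction Z rule: finite_psubset_induct)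
  case (psubset Z)
  define L where "L z = {l \<in> B \<times> UNIV. step l z \<in> Z}" for z
  have finL: "finite (L z)" for z
    using finite_basis by (simp add: L_def)
  show ?case
  proof (cases "\<forall>z\<in>Z. 2 \<le> card (L z)")
    case True
    then show ?thesis
      using closed_reduced_walk_min_degree[of Z] psubset.hyps psubset.prems by (simp add: L_def)
  next
    case False
    then obtain v where v: "v \<in> Z" "card (L v) \<le> 1" by force
    define I where "I = {(x, b) \<in> edges Z. x = v \<or> \<phi> b x = v}"
    \<comment> \<open>The letter that is read at \<open>v\<close> when the edge is traversed starting at \<open>v\<close>. A loop at \<open>v\<close>
      is counted once here, but accounts for two letters at \<open>v\<close>.\<close>
    define f where "f = (\<lambda>(x, b :: 'a). (b, x = v))"
    have "inj_on f I"
    proof (rule inj_onI)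
      fix p q assume pq: "p \<in> I" "q \<in> I" "f p = f q"
      obtain x b where p: "p = (x, b)" by (cases p)
      obtain y where q: "q = (y, b)" "(x = v) = (y = v)"
        using pq(3) p by (cases q) (auto simp: f_def)
      have "x \<in> S" "y \<in> S" "b \<in> carrier G" and eq: "x = v \<or> \<phi> b x = v" "y = v \<or> \<phi> b y = v"
        using pq p q psubset.prems basis_closed by (auto simp: I_def inner_edges_def)
      then have "x = y" using act_inj[of b x y] q(2) by metis
      then show "p = q" using p q by simp
    qed
    moreover have "f ` I \<subseteq> L v"
    proof
      fix l assume "l \<in> f ` I"
      then obtain x b where xb: "(x, b) \<in> I" and l: "l = (b, x = v)"
        by (auto simp: f_def)
      have x: "x \<in> Z" "x \<in> S" "b \<in> B" "\<phi> b x \<in> Z" "x = v \<or> \<phi> b x = v"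
        using xb psubset.prems by (auto simp: I_def inner_edges_def)
      show "l \<in> L v"
      proof (cases "x = v")
        case True
        then show ?thesis using x l by (simp add: L_def letter_value_def)
      next
        case False
        then have "\<phi> (inv b) v = x" using x act_inv_act basis_closed by metis
        then show ?thesis using x l False by (simp add: L_def letter_value_def)
      qed
    qed
    ultimately have I: "card I \<le> 1"
      using card_inj_on_le[OF _ _ finL, of f I v] v(2) by linarith
    have finE: "finite (edges Z)"
      using finite_inner_edges psubset.hyps finite_basis by blast
    have "edges Z = edges (Z - {v}) \<union> I"
      by (auto simp: I_def inner_edges_def)
    then have "card (edges Z) \<le> card (edges (Z - {v})) + card I"
      by (metis card_Un_le)
    then have E: "card (Z - {v}) \<le> card (edges (Z - {v}))"
      using I psubset.prems psubset.hyps v(1) by simp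
    have "Z - {v} \<noteq> {}"
    proof
      assume "Z - {v} = {}"
      then have Zv: "Z = {v}" using v by auto
      then have "0 < card (edges Z)" using psubset.prems by simp
      then obtain b where b: "b \<in> B" "\<phi> b v = v"
        unfolding Zv by (auto simp: inner_edges_def card_gt_0_iff)
      have "v \<in> S" using v(1) psubset.prems by auto
      then have "\<phi> (inv b) v = v" using b act_inv_act basis_closed by metis
      then have "{(b, True), (b, False)} \<subseteq> L v"
        using b Zv by (auto simp: L_def letter_value_def)
      then have "card {(b, True), (b, False)} \<le> card (L v)"
        using finL by (intro card_mono)
      then show False using v(2) by simp
    qed
    then obtain z w where "z \<in> Z - {v}" "w \<in> reduced_words B" "w \<noteq> []"
      "length w \<le> card (Z - {v})" "\<phi> (word_value G w) z = z"
      using psubset.IH[of "Z - {v}"] E psubset.prems v(1) by blast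
    moreover have "card (Z - {v}) \<le> card Z"
      using psubset.hyps by (simp add: card_Diff1_le)
    ultimately show ?thesis by (meson DiffD1 order_trans)
  qed
qed

text \<open>
  The double cover of the graph in which exactly the edges in \<open>E\<close> switch the two sheets. Then
  \<open>hol g x\<close> tells whether the path from \<open>x\<close> along \<open>g\<close> ends on the other sheet, that is, the parity of
  its number of passages through \<open>E\<close>.
\<close>

lemma twisted_action_exists:
  assumes E: "E \<subseteq> S \<times> B"
  shows "\<exists>\<psi> hol. right_action G (S \<times> UNIV) \<psi> \<and>
     (\<forall>g\<in>carrier G. \<forall>x\<in>S. \<forall>e. \<psi> g (x, e) = (\<phi> g x, e \<noteq> hol g x)) \<and>
     (\<forall>b\<in>B. \<forall>x\<in>S. hol b x \<longleftrightarrow> (x, b) \<in> E)"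
proof -
  define \<sigma> where "\<sigma> b = (\<lambda>(x, e). (\<phi> b x, e \<noteq> ((x, b) \<in> E)))" for b
  have bij: "bij_betw (\<sigma> b) (S \<times> UNIV) (S \<times> UNIV)" if b: "b \<in> B" for b
  proof (rule bij_betwI[where g = "\<lambda>(x, e). (\<phi> (inv b) x, e \<noteq> ((\<phi> (inv b) x, b) \<in> E))"])
    note c = basis_closed[OF b]
    show "\<sigma> b \<in> S \<times> UNIV \<rightarrow> S \<times> UNIV"
      using act_closed[OF c] by (auto simp: \<sigma>_def)
    show "(\<lambda>(x, e). (\<phi> (inv b) x, e \<noteq> ((\<phi> (inv b) x, b) \<in> E))) \<in> S \<times> UNIV \<rightarrow> S \<times> UNIV"
      using act_closed[OF inv_closed[OF c]] by auto
    show "(\<lambda>(x, e). (\<phi> (inv b) x, e \<noteq> ((\<phi> (inv b) x, b) \<in> E))) (\<sigma> b p) = p"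
      if "p \<in> S \<times> UNIV" for p
      using that act_inv_act[OF c] by (auto simp: \<sigma>_def)
    show "\<sigma> b ((\<lambda>(x, e). (\<phi> (inv b) x, e \<noteq> ((\<phi> (inv b) x, b) \<in> E))) p) = p"
      if "p \<in> S \<times> UNIV" for p
      using that act_act_inv[OF c] by (auto simp: \<sigma>_def)
  qed
  obtain \<psi> where \<psi>: "right_action G (S \<times> UNIV) \<psi>"
    and \<psi>B: "\<forall>b\<in>B. \<forall>p\<in>S \<times> UNIV. \<psi> b p = \<sigma> b p"
    using free_basis_action[of G B \<sigma> "S \<times> UNIV", OF is_group basis bij] by blast
  interpret T: right_action G "S \<times> (UNIV :: bool set)" \<psi> by (rule \<psi>)
  define hol where "hol g x = snd (\<psi> g (x, False))" for g x
  have *: "\<forall>x\<in>S. \<exists>c. \<forall>e. \<psi> g (x, e) = (\<phi> g x, e \<noteq> c)" if "g \<in> carrier G" for g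
    using that
  proof (induction rule: basis_induct)
    case one
    have "\<psi> \<one> (x, e) = (\<phi> \<one> x, e \<noteq> False)" if "x \<in> S" for x e
      using that T.act_one act_one by simp
    then show ?case by blast
  next
    case (pos b g)
    note c = basis_closed[OF pos(1)]
    show ?case
    proof
      fix x assume x: "x \<in> S"
      obtain k where k: "\<And>e. \<psi> g (\<phi> b x, e) = (\<phi> g (\<phi> b x), e \<noteq> k)"
        using pos.IH act_closed[OF c x] by blast
      have "\<psi> (b \<otimes> g) (x, e) = (\<phi> (b \<otimes> g) x, e \<noteq> (((x, b) \<in> E) \<noteq> k))" for e
        using T.act_mult[OF c pos(2), of "(x, e)"] act_mult[OF c pos(2) x] x k \<psi>B pos(1)
        by (auto simp: \<sigma>_def)
      then show "\<exists>k. \<forall>e. \<psi> (b \<otimes> g) (x, e) = (\<phi> (b \<otimes> g) x, e \<noteq> k)" by blast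
    qed
  next
    case (neg b g)
    note c = basis_closed[OF neg(1)]
    show ?case
    proof
      fix x assume x: "x \<in> S"
      let ?y = "\<phi> (inv b) x"
      have y: "?y \<in> S" using act_closed[OF inv_closed[OF c] x] .
      obtain k where k: "\<And>e. \<psi> g (?y, e) = (\<phi> g ?y, e \<noteq> k)"
        using neg.IH y by blast
      have "\<psi> (inv b) (x, e) = (?y, e \<noteq> ((?y, b) \<in> E))" for e
      proof -
        have "\<psi> b (?y, e \<noteq> ((?y, b) \<in> E)) = (x, e)"
          using \<psi>B neg(1) y act_act_inv[OF c x] by (auto simp: \<sigma>_def)
        then show ?thesis
          using T.act_inv_act[OF c, of "(?y, e \<noteq> ((?y, b) \<in> E))"] y by simp
      qed
      then have "\<psi> (inv b \<otimes> g) (x, e) = (\<phi> (inv b \<otimes> g) x, e \<noteq> (((?y, b) \<in> E) \<noteq> k))" for e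
        using T.act_mult[OF inv_closed[OF c] neg(2), of "(x, e)"]
          act_mult[OF inv_closed[OF c] neg(2) x] x k by auto
      then show "\<exists>k. \<forall>e. \<psi> (inv b \<otimes> g) (x, e) = (\<phi> (inv b \<otimes> g) x, e \<noteq> k)" by blast
    qed
  qed
  have "\<psi> g (x, e) = (\<phi> g x, e \<noteq> hol g x)" if g: "g \<in> carrier G" and x: "x \<in> S" for g x e
  proof -
    obtain k where k: "\<And>e. \<psi> g (x, e) = (\<phi> g x, e \<noteq> k)" using *[OF g] x by blast
    from k[of False] have "hol g x = k" by (simp add: hol_def)
    with k show ?thesis by simp
  qed
  moreover have "hol b x \<longleftrightarrow> (x, b) \<in> E" if "b \<in> B" "x \<in> S" for b x
    using \<psi>B that by (simp add: hol_def \<sigma>_def)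
  ultimately show ?thesis using \<psi> by blast
qed

text \<open>
  In topological terms: if the stabilizer of \<open>p\<close>, which is the fundamental group of the component of
  \<open>p\<close>, is generated by \<open>card T\<close> elements, then a subgraph with \<open>n\<close> vertices has at most
  \<open>n + card T\<close> edges. The proof counts double covers. A set \<open>E\<close> of edges inside \<open>Z\<close> can be recovered
  from the parities of the generators and of one path from \<open>p\<close> to each vertex of \<open>Z\<close>, because the
  former determine the parity of every closed path at \<open>p\<close>. Hence there are at most
  \<open>2 ^ (card T + card Z)\<close> such sets.
\<close>

lemma card_edges_le_rank:
  assumes Z: "finite Z" "Z \<subseteq> S"
    and p: "p \<in> S" and orb: "\<And>x. x \<in> Z \<Longrightarrow> \<exists>g\<in>carrier G. \<phi> g p = x"
    and T: "finite T" "\<And>t. t \<in> T \<Longrightarrow> t \<in> carrier G \<and> \<phi> t p = p"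
    and stab: "\<And>g. g \<in> carrier G \<Longrightarrow> \<phi> g p = p \<Longrightarrow> g \<in> generate G T"
  shows "card (edges Z) \<le> card Z + card T"
proof -
  have finE: "finite (edges Z)"
    using finite_inner_edges Z(1) finite_basis by blast
  have sub: "E \<subseteq> S \<times> B" if "E \<subseteq> edges Z" for E
    using that Z(2) by (auto simp: inner_edges_def)
  define cocycle where "cocycle E hol \<longleftrightarrow>
      (\<forall>g\<in>carrier G. \<forall>h\<in>carrier G. \<forall>x\<in>S. hol (g \<otimes> h) x \<longleftrightarrow> hol g x \<noteq> hol h (\<phi> g x)) \<and>
      (\<forall>b\<in>B. \<forall>x\<in>S. hol b x \<longleftrightarrow> (x, b) \<in> E)" for E hol
  have "\<exists>hol. cocycle E hol" if E: "E \<subseteq> edges Z" for E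
  proof -
    obtain \<psi> hol where \<psi>: "right_action G (S \<times> UNIV) \<psi>"
      and hol: "\<forall>g\<in>carrier G. \<forall>x\<in>S. \<forall>e. \<psi> g (x, e) = (\<phi> g x, e \<noteq> hol g x)"
      and holB: "\<forall>b\<in>B. \<forall>x\<in>S. hol b x \<longleftrightarrow> (x, b) \<in> E"
      using twisted_action_exists[OF sub[OF E]] by blast
    interpret T: right_action G "S \<times> (UNIV :: bool set)" \<psi> by (rule \<psi>)
    have "hol (g \<otimes> h) x \<longleftrightarrow> hol g x \<noteq> hol h (\<phi> g x)"
      if "g \<in> carrier G" "h \<in> carrier G" "x \<in> S" for g h x
      using T.act_mult[OF that(1,2), of "(x, False)"] hol that act_closed by auto
    then show ?thesis using holB unfolding cocycle_def by blast
  qed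
  then obtain hol where hol: "\<And>E. E \<subseteq> edges Z \<Longrightarrow> cocycle E (hol E)"
    by metis
  have holm: "\<And>E g h x. E \<subseteq> edges Z \<Longrightarrow> g \<in> carrier G \<Longrightarrow> h \<in> carrier G \<Longrightarrow> x \<in> S \<Longrightarrow>
         hol E (g \<otimes> h) x \<longleftrightarrow> hol E g x \<noteq> hol E h (\<phi> g x)"
    and holB: "\<And>E b x. E \<subseteq> edges Z \<Longrightarrow> b \<in> B \<Longrightarrow> x \<in> S \<Longrightarrow> hol E b x \<longleftrightarrow> (x, b) \<in> E"
    using hol unfolding cocycle_def by blast+
  have hol1: "\<not> hol E \<one> x" if "E \<subseteq> edges Z" "x \<in> S" for E x
    using holm[OF that(1) one_closed one_closed that(2)] act_one[OF that(2)] by auto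
  have stab_hol: "h \<in> carrier G \<and> \<phi> h p = p \<and> (hol E h p \<longleftrightarrow> hol E' h p)"
    if h: "h \<in> generate G T" and E: "E \<subseteq> edges Z" "E' \<subseteq> edges Z"
      and eq: "\<And>t. t \<in> T \<Longrightarrow> hol E t p \<longleftrightarrow> hol E' t p" for h E E'
    using h
  proof (induction rule: generate.induct)
    case one
    then show ?case using hol1 E p act_one by simp
  next
    case (incl t)
    then show ?case using T eq by blast
  next
    case (inv t)
    have t: "t \<in> carrier G" "\<phi> t p = p" using T inv by auto
    have fx: "\<phi> (inv t) p = p" using act_inv_act[OF t(1) p] t(2) by simp
    have "hol D (inv t) p \<longleftrightarrow> hol D t p" if "D \<subseteq> edges Z" for D
      using holm[OF that inv_closed[OF t(1)] t(1) p] fx hol1[OF that p] l_inv[OF t(1)] by simp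
    then show ?case using E eq[OF inv] t fx by simp
  next
    case (eng g h)
    then show ?case using holm E p act_mult by (metis m_closed)
  qed
  obtain r where r: "\<And>x. x \<in> Z \<Longrightarrow> r x \<in> carrier G \<and> \<phi> (r x) p = x"
    using orb by metis
  define \<Theta> where "\<Theta> E = ({t \<in> T. hol E t p}, {x \<in> Z. hol E (r x) p})" for E
  have "inj_on \<Theta> (Pow (edges Z))"
  proof (rule inj_onI)
    fix E E' assume "E \<in> Pow (edges Z)" "E' \<in> Pow (edges Z)" and eq: "\<Theta> E = \<Theta> E'"
    then have E: "E \<subseteq> edges Z" "E' \<subseteq> edges Z" by auto
    have eqT: "\<And>t. t \<in> T \<Longrightarrow> hol E t p \<longleftrightarrow> hol E' t p"
      and eqZ: "\<And>x. x \<in> Z \<Longrightarrow> hol E (r x) p \<longleftrightarrow> hol E' (r x) p"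
      using eq by (auto simp: \<Theta>_def)
    have "(x, b) \<in> E \<longleftrightarrow> (x, b) \<in> E'" if xb: "(x, b) \<in> edges Z" for x b
    proof -
      let ?y = "\<phi> b x"
      have x: "x \<in> Z" "x \<in> S" "b \<in> B" "b \<in> carrier G" "?y \<in> Z" "?y \<in> S"
        using xb Z basis_closed by (auto simp: inner_edges_def)
      note rx = r[OF x(1)] and ry = r[OF x(5)]
      \<comment> \<open>The closed path from \<open>p\<close> to \<open>x\<close>, along the edge \<open>(x, b)\<close>, and back to \<open>p\<close>.\<close>
      define h where "h = r x \<otimes> b \<otimes> inv (r ?y)"
      have h: "h \<in> carrier G" "r x \<otimes> b = h \<otimes> r ?y"
        using rx ry x by (auto simp: h_def m_assoc)
      have "\<phi> (r x \<otimes> b) p = ?y" using act_mult rx x p by simp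
      then have "\<phi> h p = p"
        using act_mult[of "r x \<otimes> b" "inv (r ?y)" p] act_inv_act[of "r ?y" p] rx ry x p
        by (simp add: h_def)
      then have gen: "h \<in> generate G T" using stab h by simp
      have "(x, b) \<in> D \<longleftrightarrow> (hol D (r x) p \<noteq> (hol D h p \<noteq> hol D (r ?y) p))" if D: "D \<subseteq> edges Z" for D
      proof -
        have "hol D (r x \<otimes> b) p \<longleftrightarrow> hol D (r x) p \<noteq> ((x, b) \<in> D)"
          using holm[OF D _ x(4) p] holB[OF D x(3,2)] rx by simp
        moreover have "hol D (h \<otimes> r ?y) p \<longleftrightarrow> hol D h p \<noteq> hol D (r ?y) p"
          using holm[OF D h(1) _ p] ry \<open>\<phi> h p = p\<close> by simp
        ultimately show ?thesis using h(2) by auto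
      qed
      then show ?thesis
        using stab_hol[OF gen E eqT] eqZ[OF x(1)] eqZ[OF x(5)] E by simp
    qed
    then show "E = E'" using E by auto
  qed
  moreover have "\<Theta> ` Pow (edges Z) \<subseteq> Pow T \<times> Pow Z"
    by (auto simp: \<Theta>_def)
  ultimately have "card (Pow (edges Z)) \<le> card (Pow T \<times> Pow Z)"
    using T Z by (intro card_inj_on_le[of \<Theta>]) auto
  then have "2 ^ card (edges Z) \<le> (2 :: nat) ^ (card T + card Z)"
    using T Z finE by (simp add: card_Pow card_cartesian_product power_add)
  then show ?thesis by simp
qed

end

section \<open>Residual finiteness\<close>

lemma finite_partial_injection_extends:
  assumes Y: "finite Y" and D: "D \<subseteq> Y" "inj_on p D" "p ` D \<subseteq> Y"
  shows "\<exists>\<sigma>. bij_betw \<sigma> Y Y \<and> (\<forall>y\<in>D. \<sigma> y = p y)"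
proof -
  have "finite D" using Y D finite_subset by blast
  then have "card (Y - D) = card (Y - p ` D)"
    using Y D by (simp add: card_Diff_subset card_image)
  then obtain q where q: "bij_betw q (Y - D) (Y - p ` D)"
    using finite_same_card_bij Y by blast
  define \<sigma> where "\<sigma> y = (if y \<in> D then p y else q y)" for y
  have "bij_betw \<sigma> D (p ` D)"
    using D(2) by (simp add: \<sigma>_def bij_betw_def cong: inj_on_cong image_cong)
  moreover have "bij_betw \<sigma> (Y - D) (Y - p ` D)"
    using q by (rule bij_betw_cong[THEN iffD1, rotated]) (simp add: \<sigma>_def)
  ultimately have "bij_betw \<sigma> (D \<union> (Y - D)) (p ` D \<union> (Y - p ` D))"
    by (rule bij_betw_combine) auto
  moreover have "D \<union> (Y - D) = Y" "p ` D \<union> (Y - p ` D) = Y" using D by auto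
  ultimately have "bij_betw \<sigma> Y Y" by simp
  then show ?thesis by (auto simp: \<sigma>_def)
qed

context group
begin

lemma finite_index_power_mem:
  assumes K: "subgroup K G" "finite (rcosets K)" and g: "g \<in> carrier G"
  shows "\<exists>n>0. g [^] (n :: nat) \<in> K"
proof -
  have "range (\<lambda>n :: nat. K #> (g [^] n)) \<subseteq> rcosets K"
    using g by (auto simp: RCOSETS_def)
  then have "finite (range (\<lambda>n :: nat. K #> (g [^] n)))"
    using K(2) finite_subset by blast
  then have "\<not> inj (\<lambda>n :: nat. K #> (g [^] n))"
    using finite_imageD infinite_UNIV_nat by blast
  then obtain i j :: nat where ij: "i < j" "K #> (g [^] i) = K #> (g [^] j)"
    unfolding inj_def by (metis nat_neq_iff)
  have "g [^] j \<in> K #> (g [^] i)"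
    using ij rcos_self[OF _ K(1), of "g [^] j"] g by simp
  then obtain k where k: "k \<in> K" "g [^] j = k \<otimes> g [^] i"
    by (auto simp: r_coset_def)
  have "g [^] j = g [^] (j - i) \<otimes> g [^] i"
    using ij g by (simp add: nat_pow_mult)
  then have "g [^] (j - i) = k"
    using k g subgroup.mem_carrier[OF K(1)] by (metis nat_pow_closed right_cancel)
  then show ?thesis using k ij by (intro exI[of _ "j - i"]) auto
qed

end

context right_action
begin

text \<open>
  A coset of the kernel is determined by the permutation of the finite set \<open>S\<close> that it induces.
\<close>

lemma kernel_normal_finite_index:
  assumes "finite S"
  defines "K \<equiv> {g \<in> carrier G. \<forall>x\<in>S. \<phi> g x = x}"
  shows "K \<lhd> G" "finite (rcosets K)"
proof -
  have sub: "subgroup K G"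
  proof (rule subgroupI)
    show "K \<subseteq> carrier G" by (auto simp: K_def)
    show "K \<noteq> {}" using act_one by (auto simp: K_def)
    show "inv a \<in> K" if "a \<in> K" for a
      using that act_inv_act by (auto simp: K_def) (metis act_inv_act)
    show "a \<otimes> b \<in> K" if "a \<in> K" "b \<in> K" for a b
      using that act_mult by (auto simp: K_def)
  qed
  have conj: "x \<otimes> h \<otimes> inv x \<in> K" if "x \<in> carrier G" "h \<in> K" for x h
    using that act_mult act_closed act_inv_act by (auto simp: K_def) 
  show "K \<lhd> G"
    unfolding normal_inv_iff using sub conj by blast
  have "K #> g = K #> h" if g: "g \<in> carrier G" and h: "h \<in> carrier G"
    and eq: "restrict (\<phi> g) S = restrict (\<phi> h) S" for g h
  proof -
    have "\<phi> (g \<otimes> inv h) x = x" if x: "x \<in> S" for x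
    proof -
      have "\<phi> g x = \<phi> h x" using eq x by (metis restrict_apply')
      then show ?thesis using act_mult[of g "inv h" x] act_inv_act g h x by simp
    qed
    then have "g \<otimes> inv h \<in> K" using g h by (auto simp: K_def)
    then have "g \<in> K #> h"
      using g h by (auto simp: r_coset_def m_assoc intro!: bexI[of _ "g \<otimes> inv h"])
    then show ?thesis using repr_independence[OF _ h sub] by simp
  qed
  then have eqc: "\<And>g h. g \<in> carrier G \<Longrightarrow> h \<in> carrier G \<Longrightarrow>
    restrict (\<phi> g) S = restrict (\<phi> h) S \<Longrightarrow> K #> g = K #> h" .
  let ?f = "\<lambda>g. restrict (\<phi> g) S"
  have "finite (?f ` carrier G)"
    by (rule finite_subset[OF _ finite_PiE[of S "\<lambda>_. S"]])
      (use assms(1) act_closed in \<open>auto simp: PiE_iff\<close>)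
  moreover have "rcosets K \<subseteq> (\<lambda>f. K #> (inv_into (carrier G) ?f f)) ` (?f ` carrier G)"
  proof
    fix C assume "C \<in> rcosets K"
    then obtain g where g: "g \<in> carrier G" "C = K #> g" by (auto simp: RCOSETS_def)
    have "inv_into (carrier G) ?f (?f g) \<in> carrier G" using g by (intro inv_into_into) auto
    moreover have "?f (inv_into (carrier G) ?f (?f g)) = ?f g" using g by (intro f_inv_into_f) auto
    ultimately have "C = K #> inv_into (carrier G) ?f (?f g)"
      using eqc[of g "inv_into (carrier G) ?f (?f g)"] g by simp
    then show "C \<in> (\<lambda>f. K #> (inv_into (carrier G) ?f f)) ` (?f ` carrier G)"
      using g by blast
  qed
  ultimately show "finite (rcosets K)" by (meson finite_imageI finite_subset)
qed

end

context finite_free_basis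
begin

lemma finite_ball: "finite (word_value G ` {w. set w \<subseteq> B \<times> UNIV \<and> length w \<le> n})"
  using finite_lists_length_le[of "B \<times> (UNIV :: bool set)" n] finite_basis by simp

text \<open>
  Right multiplication by a basis element is a partial injection of the ball of radius \<open>n\<close>. Extend
  these partial injections to permutations of the ball. A word \<open>w\<close> of length at most \<open>n\<close> then moves the
  unit element to \<open>word_value G w\<close> inside the ball, so that nontrivial short words act nontrivially.
\<close>

lemma residually_finite:
  "\<exists>K. K \<lhd> G \<and> finite (rcosets K) \<and>
     (\<forall>w\<in>reduced_words B. length w \<le> n \<longrightarrow> word_value G w \<in> K \<longrightarrow> w = [])"
proof -
  define Y where "Y = word_value G ` {w. set w \<subseteq> B \<times> UNIV \<and> length w \<le> n}"
  have Y: "finite Y" "Y \<subseteq> carrier G"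
    using finite_ball word_closed by (auto simp: Y_def)
  have "\<exists>\<sigma>. bij_betw \<sigma> Y Y \<and> (\<forall>y\<in>{y \<in> Y. y \<otimes> b \<in> Y}. \<sigma> y = y \<otimes> b)" if b: "b \<in> B" for b
  proof (rule finite_partial_injection_extends)
    show "inj_on (\<lambda>y. y \<otimes> b) {y \<in> Y. y \<otimes> b \<in> Y}"
      using Y(2) basis_closed[OF b]
      by (intro inj_onI) (metis (no_types, lifting) mem_Collect_eq right_cancel subsetD)
  qed (use Y in auto)
  then obtain \<sigma> where \<sigma>: "\<And>b. b \<in> B \<Longrightarrow> bij_betw (\<sigma> b) Y Y"
    and \<sigma>m: "\<And>b y. b \<in> B \<Longrightarrow> y \<in> Y \<Longrightarrow> y \<otimes> b \<in> Y \<Longrightarrow> \<sigma> b y = y \<otimes> b"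
    by (metis (mono_tags, lifting) mem_Collect_eq)
  obtain \<psi> where \<psi>: "right_action G Y \<psi>" and \<psi>B: "\<forall>b\<in>B. \<forall>y\<in>Y. \<psi> b y = \<sigma> b y"
    using free_basis_action[of G B \<sigma> Y, OF is_group basis \<sigma>] by blast
  interpret A: right_action G Y \<psi> by (rule \<psi>)
  have letter: "\<psi> (letter_value G (b, s)) y = y \<otimes> letter_value G (b, s)"
    if b: "b \<in> B" and y: "y \<in> Y" "y \<otimes> letter_value G (b, s) \<in> Y" for b s y
  proof (cases s)
    case True
    then show ?thesis using \<psi>B \<sigma>m b y by (simp add: letter_value_def)
  next
    case False
    have c: "b \<in> carrier G" "y \<in> carrier G" using basis_closed b y Y by auto
    have "y \<otimes> inv b \<in> Y" using y False by (simp add: letter_value_def)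
    moreover have "y \<otimes> inv b \<otimes> b = y" using c by (simp add: m_assoc)
    ultimately have "\<psi> b (y \<otimes> inv b) = y" using \<psi>B \<sigma>m b y by simp
    then show ?thesis
      using A.act_inv_act[OF c(1) \<open>y \<otimes> inv b \<in> Y\<close>] False by (simp add: letter_value_def)
  qed
  have path: "\<psi> (word_value G v) (word_value G u) = word_value G (u @ v)"
    if "set u \<subseteq> B \<times> UNIV" "set v \<subseteq> B \<times> UNIV" "length (u @ v) \<le> n" for u v
    using that
  proof (induction v arbitrary: u)
    case Nil
    then have "word_value G u \<in> Y" by (auto simp: Y_def)
    then show ?case using A.act_one by simp
  next
    case (Cons l v)
    obtain b s where l: "l = (b, s)" "b \<in> B" using Cons.prems by (cases l) auto
    have u: "word_value G u \<in> Y" "word_value G (u @ [l]) \<in> Y"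
      using Cons.prems by (auto simp: Y_def)
    have ul: "word_value G (u @ [l]) = word_value G u \<otimes> letter_value G l"
      using word_append[of u "[l]"] Cons.prems l letter_closed by auto
    have "\<psi> (word_value G (l # v)) (word_value G u)
        = \<psi> (word_value G v) (\<psi> (letter_value G l) (word_value G u))"
      using A.act_mult[OF letter_closed[OF l(2)] word_closed u(1), of v s] Cons.prems l by simp
    also have "\<psi> (letter_value G l) (word_value G u) = word_value G (u @ [l])"
      using letter[OF l(2) u(1)] u(2) ul l by simp
    also have "\<psi> (word_value G v) \<dots> = word_value G (u @ l # v)"
      using Cons.IH[of "u @ [l]"] Cons.prems by simp
    finally show ?case .
  qed
  define K where "K = {g \<in> carrier G. \<forall>y\<in>Y. \<psi> g y = y}"
  have "w = []" if w: "w \<in> reduced_words B" "length w \<le> n" "word_value G w \<in> K" for w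
  proof -
    have "\<one> \<in> Y" by (force simp: Y_def intro!: image_eqI[of _ _ "[]"])
    then have "\<psi> (word_value G w) \<one> = \<one>" using w by (simp add: K_def)
    moreover have "\<psi> (word_value G w) \<one> = word_value G w"
      using path[of "[]" w] reduced_words_subset[OF w(1)] w(2) by simp
    ultimately show ?thesis using reduced_word_one w(1) by metis
  qed
  then show ?thesis
    using A.kernel_normal_finite_index[OF Y(1)] unfolding K_def[symmetric] by blast
qed

end

section \<open>Sparse coset graphs\<close>

definition sparse :: "('a \<Rightarrow> 'x \<Rightarrow> 'x) \<Rightarrow> 'a set \<Rightarrow> 'x set \<Rightarrow> bool" where
  "sparse \<phi> B S \<longleftrightarrow>
     (\<forall>Z. finite Z \<longrightarrow> Z \<subseteq> S \<longrightarrow> 2 * card (inner_edges \<phi> B Z) \<le> 3 * card Z)"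

text \<open>
  Compared with \<open>sparse\<close>, the inequality has room for one more edge. The gluing construction uses up
  this room once in every piece.
\<close>

definition strictly_sparse :: "('a \<Rightarrow> 'x \<Rightarrow> 'x) \<Rightarrow> 'a set \<Rightarrow> 'x set \<Rightarrow> bool" where
  "strictly_sparse \<phi> B S \<longleftrightarrow>
     (\<forall>Z. finite Z \<longrightarrow> Z \<subseteq> S \<longrightarrow> Z \<noteq> {} \<longrightarrow>
        2 * card (inner_edges \<phi> B Z) + 2 \<le> 3 * card Z)"

abbreviation coset_action :: "('a, 'c) monoid_scheme \<Rightarrow> 'a set \<Rightarrow> 'a \<Rightarrow> 'a set \<Rightarrow> 'a set" where
  "coset_action G H \<equiv> \<lambda>g. restrict (\<lambda>C. C #>\<^bsub>G\<^esub> g) (rcosets\<^bsub>G\<^esub> H)"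

context group
begin

lemma coset_right_action:
  assumes H: "subgroup H G"
  shows "right_action G (rcosets H) (coset_action G H)"
proof (rule right_action_restrict)
  have sub: "C \<subseteq> carrier G" if "C \<in> rcosets H" for C
    using rcosets_subset_PowG[OF H] that by auto
  show "C #> g \<in> rcosets H" if "g \<in> carrier G" "C \<in> rcosets H" for g C
    using that coset_mult_assoc[OF subgroup.subset[OF H]] by (auto simp: RCOSETS_def)
  show "C #> \<one> = C" if "C \<in> rcosets H" for C
    using coset_mult_one[OF sub[OF that]] .
  show "C #> (g \<otimes> h) = C #> g #> h"
    if "g \<in> carrier G" "h \<in> carrier G" "C \<in> rcosets H" for g h C
    using coset_mult_assoc[OF sub[OF that(3)] that(1,2)] by simp
qed (rule is_group)

lemma coset_fixed_iff:
  assumes "subgroup H G" "g \<in> carrier G"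
  shows "H #> g = H \<longleftrightarrow> g \<in> H"
  using assms coset_join2 rcos_self by metis

end

context finite_free_basis
begin

text \<open>
  A nontrivial closed reduced walk reads a conjugate of an element of \<open>H \<subseteq> K\<close>, which is long by
  assumption. So a set of at most \<open>2 k + 2\<close> vertices spans a forest, while for a larger set the bound
  \<open>card Z + k\<close> from \<open>card_edges_le_rank\<close> is at most \<open>3/2 card Z - 1\<close>.
\<close>

lemma coset_action_strictly_sparse:
  assumes K: "K \<lhd> G"
    and short: "\<And>w. w \<in> reduced_words B \<Longrightarrow> length w \<le> 2 * k + 2 \<Longrightarrow> word_value G w \<in> K \<Longrightarrow> w = []"
    and T: "finite T" "T \<subseteq> K" "card T \<le> k"
  defines "H \<equiv> generate G T"
  shows "strictly_sparse (coset_action G H) B (rcosets H)"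
proof -
  have KG: "subgroup K G" using K by (simp add: normal_imp_subgroup)
  have TG: "T \<subseteq> carrier G" using T subgroup.subset[OF KG] by blast
  have H: "subgroup H G" unfolding H_def using generate_is_subgroup[OF TG] .
  have HK: "H \<subseteq> K" unfolding H_def using generate_subgroup_incl[OF T(2) KG] .
  interpret A: right_action G "rcosets H" "coset_action G H"
    by (rule coset_right_action[OF H])
  interpret A: free_group_action G B "rcosets H" "coset_action G H" ..
  have "2 * card (A.edges Z) + 2 \<le> 3 * card Z"
    if Z: "finite Z" "Z \<subseteq> rcosets H" "Z \<noteq> {}" for Z
  proof (cases "card Z \<le> 2 * k + 2")
    case True
    have "card (A.edges Z) < card Z"
    proof (rule ccontr)
      assume "\<not> ?thesis"
      then obtain C w where C: "C \<in> Z" and w: "w \<in> reduced_words B" "w \<noteq> []" "length w \<le> card Z"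
        and fixed: "coset_action G H (word_value G w) C = C"
        using A.closed_reduced_walk[OF Z(1,3,2)] by (auto simp: not_less)
      obtain u where u: "u \<in> carrier G" "C = H #> u"
        using C Z by (auto simp: RCOSETS_def)
      let ?g = "word_value G w"
      have g: "?g \<in> carrier G" using word_closed reduced_words_subset w(1) by blast
      have "H #> (u \<otimes> ?g) = H #> u"
        using fixed C Z(2) u coset_mult_assoc[OF subgroup.subset[OF H] u(1) g] by auto
      then have "u \<otimes> ?g \<in> H #> u"
        using rcos_self[OF m_closed[OF u(1) g] H] by simp
      then obtain h where h: "h \<in> H" "u \<otimes> ?g = h \<otimes> u"
        by (auto simp: r_coset_def)
      have hG: "h \<in> carrier G" using subgroup.mem_carrier[OF H h(1)] .
      have "?g = inv u \<otimes> (u \<otimes> ?g)"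
        using u g by (simp add: m_assoc[symmetric])
      also have "\<dots> = inv u \<otimes> h \<otimes> u"
        using u hG h(2) by (simp add: m_assoc)
      finally have "?g = inv u \<otimes> h \<otimes> u" .
      then have "?g \<in> K"
        using normal.inv_op_closed1[OF K u(1)] h HK by auto
      with short[OF w(1)] w True show False by simp
    qed
    moreover have "0 < card Z" using Z by (simp add: card_gt_0_iff)
    ultimately show ?thesis by linarith
  next
    case False
    have "card (A.edges Z) \<le> card Z + card T"
    proof (rule A.card_edges_le_rank[OF Z(1,2), of H])
      show Hin: "H \<in> rcosets H" using subgroup.subgroup_in_rcosets[OF H is_group] .
      show "\<exists>g\<in>carrier G. coset_action G H g H = C" if "C \<in> Z" for C
        using that Z Hin by (auto simp: RCOSETS_def)
      show "t \<in> carrier G \<and> coset_action G H t H = H" if "t \<in> T" for t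
        using that TG Hin coset_fixed_iff[OF H] generate.incl[of t T G] by (auto simp: H_def)
      show "g \<in> generate G T" if "g \<in> carrier G" "coset_action G H g H = H" for g
        using that Hin coset_fixed_iff[OF H] by (simp add: H_def)
    qed (use T in auto)
    with False T show ?thesis by linarith
  qed
  then show ?thesis by (simp add: strictly_sparse_def)
qed

end

section \<open>Gluing actions along a free orbit\<close>

context free_group_action
begin

text \<open>
  Otherwise every edge that ends in \<open>D\<close> also starts in \<open>D\<close>, and \<open>D\<close> spans \<open>card B * card D\<close> edges,
  which is too many.
\<close>

lemma entering_edge_exists:
  assumes sp: "strictly_sparse \<phi> B S" and rank: "2 \<le> card B"
    and D: "finite D" "D \<subseteq> S" "D \<noteq> {}"
  shows "\<exists>b\<in>B. \<exists>y\<in>S - D. \<phi> b y \<in> D"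
proof (rule ccontr)
  assume no: "\<not> ?thesis"
  let ?f = "\<lambda>(z, b). (\<phi> (inv b) z, b)"
  have sub: "?f ` (D \<times> B) \<subseteq> edges D"
  proof clarify
    fix z b assume zb: "z \<in> D" "b \<in> B"
    have b: "b \<in> carrier G" and z: "z \<in> S" using zb D basis_closed by auto
    have undo: "\<phi> b (\<phi> (inv b) z) = z" using act_act_inv[OF b z] .
    have "\<phi> (inv b) z \<in> S" using act_closed[OF inv_closed[OF b] z] .
    then have "\<phi> (inv b) z \<in> D" by (metis DiffI no undo zb)
    then show "(\<phi> (inv b) z, b) \<in> edges D"
      using zb undo by (simp add: inner_edges_def)
  qed
  have inj: "inj_on ?f (D \<times> B)"
  proof (rule inj_onI)
    fix q q' assume *: "q \<in> D \<times> B" "q' \<in> D \<times> B" "?f q = ?f q'"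
    obtain z b where q: "q = (z, b)" "z \<in> S" "b \<in> B" using * D by auto
    obtain z' where q': "q' = (z', b)" "z' \<in> S" using * D q by auto
    have "\<phi> (inv b) z = \<phi> (inv b) z'" using * q q' by simp
    then show "q = q'"
      using act_inj[OF inv_closed[OF basis_closed[OF q(3)]] q(2) q'(2)] q q' by simp
  qed
  have "card (D \<times> B) \<le> card (edges D)"
    using card_inj_on_le[OF inj sub finite_inner_edges[OF D(1) finite_basis]] .
  then have "card D * card B \<le> card (edges D)" by (simp add: card_cartesian_product)
  moreover have "card D * 2 \<le> card D * card B" using rank by simp
  moreover have "2 * card (edges D) + 2 \<le> 3 * card D"
    using sp D by (auto simp: strictly_sparse_def)
  ultimately show False by linarith
qed

end

context finite_free_basis
begin

text \<open>
  Let \<open>D i\<close> be the ball of radius \<open>r i\<close> around \<open>p i\<close>. For each \<open>i > 0\<close> choose an edge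
  \<open>y i \<rightarrow> y i c i\<close> that enters \<open>D i\<close>, and in the free action on \<open>X 0\<close> the edge labelled \<open>c i\<close> that
  starts at a vertex \<open>spot i\<close>. Exchanging the starting points of these two edges leaves the action
  of each \<open>c i\<close> a permutation, does not touch any path inside \<open>D i\<close>, and lets one enter \<open>D i\<close> from
  \<open>X 0\<close>. The vertices \<open>spot i\<close> are \<open>p 0 a\<^sup>i b\<close> for basis elements \<open>a \<noteq> b\<close>; they are distinct, and the
  paths from \<open>p 0\<close> to them avoid the exchanged edges.
  
  The glued action is still sparse. Consider the new edges inside a finite set \<open>Z\<close>. For each \<open>i\<close> at most
  one of the two exchanged edges can be a new edge: if both are inside \<open>Z\<close>, so are the two
  original ones. This edge is charged to the nonempty set of vertices of \<open>Z\<close> in \<open>X i\<close>, where strict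
  sparseness has room for it.
\<close>

lemma glue_along_free_orbit:
  fixes X :: "nat \<Rightarrow> 'x set" and \<psi> :: "nat \<Rightarrow> 'a \<Rightarrow> 'x \<Rightarrow> 'x" and p :: "nat \<Rightarrow> 'x" and r :: "nat \<Rightarrow> nat"
  assumes rank: "2 \<le> card B"
    and act: "\<And>i. right_action G (X i) (\<psi> i)"
    and sp: "\<And>i. strictly_sparse (\<psi> i) B (X i)"
    and p: "\<And>i. p i \<in> X i"
    and free0: "\<And>g. g \<in> carrier G \<Longrightarrow> \<psi> 0 g (p 0) = p 0 \<Longrightarrow> g = \<one>"
  shows "\<exists>\<phi>. right_action G (Sigma UNIV X) \<phi> \<and> sparse \<phi> B (Sigma UNIV X) \<and>
     (\<forall>i>0. \<exists>g\<in>carrier G. \<phi> g (0, p 0) = (i, p i)) \<and>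
     (\<forall>i>0. \<forall>w. set w \<subseteq> B \<times> UNIV \<longrightarrow> length w \<le> r i \<longrightarrow>
        \<phi> (word_value G w) (i, p i) = (i, \<psi> i (word_value G w) (p i)))"
proof -
  interpret A: right_action G "X i" "\<psi> i" for i by (rule act)
  interpret A: free_group_action G B "X i" "\<psi> i" for i ..
  define D where
    "D i = (\<lambda>w. \<psi> i (word_value G w) (p i)) ` {w. set w \<subseteq> B \<times> UNIV \<and> length w \<le> r i}" for i
  have finD: "finite (D i)" for i
    using finite_lists_length_le[of "B \<times> (UNIV :: bool set)" "r i"] finite_basis
    by (simp add: D_def)
  have DX: "D i \<subseteq> X i" for i
    using A.act_closed word_closed p by (auto simp: D_def)
  have "D i \<noteq> {}" for i
    unfolding D_def by (auto intro!: exI[of _ "[]"])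
  then have "\<exists>b\<in>B. \<exists>y\<in>X i - D i. \<psi> i b y \<in> D i" for i
    using A.entering_edge_exists[OF sp rank finD DX] by blast
  then obtain c y where c: "\<And>i. c i \<in> B" and y: "\<And>i. y i \<in> X i" "\<And>i. y i \<notin> D i"
    and enter: "\<And>i. \<psi> i (c i) (y i) \<in> D i"
    by (metis DiffD1 DiffD2)
  have "\<not> card B \<le> Suc 0" using rank by simp
  then obtain a b where ab: "a \<in> B" "b \<in> B" "a \<noteq> b"
    unfolding card_le_Suc0_iff_eq[OF finite_basis] by blast

  define ray where "ray n = replicate n (a, True)" for n :: nat
  define branch where "branch n = ray n @ [(b, True)]" for n
  have reduced: "ray n \<in> reduced_words B" "branch n \<in> reduced_words B" for n
    using ab by (auto simp: ray_def branch_def reduced_words_def successively_conv_nth nth_append)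
  have rayB: "set (ray n) \<subseteq> B \<times> UNIV" and branchB: "set (branch n) \<subseteq> B \<times> UNIV" for n
    using reduced reduced_words_subset by blast+
  have orbit0_inj: "u = v"
    if "u \<in> reduced_words B" "v \<in> reduced_words B"
      and eq: "\<psi> 0 (word_value G u) (p 0) = \<psi> 0 (word_value G v) (p 0)" for u v
  proof -
    have g: "word_value G u \<in> carrier G" "word_value G v \<in> carrier G"
      using that word_closed reduced_words_subset by blast+
    have "\<psi> 0 (word_value G u \<otimes> inv (word_value G v)) (p 0) = p 0"
      using A.act_mult[OF g(1) inv_closed[OF g(2)] p] A.act_inv_act[OF g(2) p] eq by simp
    then have "word_value G u \<otimes> inv (word_value G v) = \<one>" using free0 g by simp
    then have "word_value G u = word_value G v" using g by (metis inv_equality inv_inv inv_closed)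
    then show ?thesis using reduced_word_inj that by blast
  qed
  define spot where "spot n = \<psi> 0 (word_value G (branch n)) (p 0)" for n
  have spotX: "spot n \<in> X 0" for n
    using A.act_closed word_closed branchB p by (simp add: spot_def)
  have inj_spot: "inj spot"
  proof (rule injI)
    fix m n assume "spot m = spot n"
    then have "branch m = branch n" using orbit0_inj reduced by (simp add: spot_def)
    then have "length (branch m) = length (branch n)" by simp
    then show "m = n" by (simp add: branch_def ray_def)
  qed
  have ray_spot: "\<psi> 0 (word_value G (ray m)) (p 0) \<noteq> spot n" for m n
  proof
    assume "\<psi> 0 (word_value G (ray m)) (p 0) = spot n"
    then have "ray m = branch n" using orbit0_inj reduced by (simp add: spot_def)
    then have "(b, True) \<in> set (ray m)" by (simp add: branch_def)
    then show False using ab by (simp add: ray_def)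
  qed

  define S where "S = Sigma UNIV X"
  define old where "old e = (\<lambda>(j, x). (j, \<psi> j e x))" for e
  define hooked where "hooked e = {i. 0 < i \<and> c i = e}" for e
  \<comment> \<open>The new action of \<open>e\<close> is \<open>old e\<close> after \<open>swap e\<close>, which exchanges \<open>spot i\<close> and \<open>y i\<close> for all
    \<open>i\<close> with label \<open>c i = e\<close>.\<close>
  define swap where "swap e = (\<lambda>(j, x).
      if j = 0 \<and> x \<in> spot ` hooked e then (the_inv spot x, y (the_inv spot x))
      else if j \<in> hooked e \<and> x = y j then (0, spot j)
      else (j, x))" for e
  have swap_spot: "swap e (0, spot i) = (i, y i)" if "i \<in> hooked e" for e i
    using that the_inv_f_f[OF inj_spot] by (simp add: swap_def)
  have swap_y: "swap e (i, y i) = (0, spot i)" if "i \<in> hooked e" for e i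
    using that by (simp add: swap_def hooked_def)
  have swap_other: "swap e q = q"
    if "\<And>i. i \<in> hooked e \<Longrightarrow> q \<noteq> (0, spot i)" "\<And>i. i \<in> hooked e \<Longrightarrow> q \<noteq> (i, y i)" for e q
    using that by (cases q) (auto simp: swap_def)
  have swap_S: "swap e q \<in> S" and swap_swap: "swap e (swap e q) = q" if q: "q \<in> S" for e q
  proof -
    consider i where "i \<in> hooked e" "q = (0, spot i)" | i where "i \<in> hooked e" "q = (i, y i)"
      | "\<And>i. i \<in> hooked e \<Longrightarrow> q \<noteq> (0, spot i)" "\<And>i. i \<in> hooked e \<Longrightarrow> q \<noteq> (i, y i)"
      by blast
    then have "swap e q \<in> S \<and> swap e (swap e q) = q"
    proof cases
      case 1
      then show ?thesis using swap_spot swap_y y by (simp add: S_def)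
    next
      case 2
      then show ?thesis using swap_spot swap_y spotX by (simp add: S_def)
    next
      case 3
      then show ?thesis using swap_other q by simp
    qed
    then show "swap e q \<in> S" "swap e (swap e q) = q" by auto
  qed
  have bij_swap: "bij_betw (swap e) S S" for e
    by (rule bij_betwI[where g = "swap e"]) (use swap_S swap_swap in auto)
  have bij_old: "bij_betw (old e) S S" if e: "e \<in> B" for e
  proof (rule bij_betwI[where g = "old (inv e)"])
    note ec = basis_closed[OF e]
    show "old e \<in> S \<rightarrow> S" "old (inv e) \<in> S \<rightarrow> S"
      using A.act_closed[OF ec] A.act_closed[OF inv_closed[OF ec]] by (auto simp: old_def S_def)
    show "old (inv e) (old e q) = q" "old e (old (inv e) q) = q" if "q \<in> S" for q
      using that A.act_inv_act[OF ec] A.act_act_inv[OF ec] by (auto simp: old_def S_def)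
  qed
  define \<sigma> where "\<sigma> e = old e \<circ> swap e" for e
  have bij_\<sigma>: "bij_betw (\<sigma> e) S S" if "e \<in> B" for e
    unfolding \<sigma>_def using bij_betw_trans[OF bij_swap bij_old[OF that]] .
  obtain \<phi> where \<phi>: "right_action G S \<phi>" and \<phi>B: "\<forall>e\<in>B. \<forall>q\<in>S. \<phi> e q = \<sigma> e q"
    using free_basis_action[of G B \<sigma> S, OF is_group basis bij_\<sigma>] by blast
  interpret N: right_action G S \<phi> by (rule \<phi>)
  have \<phi>_spot: "\<phi> e (0, spot i) = (i, \<psi> i e (y i))" if "e \<in> B" "i \<in> hooked e" for e i
    using that \<phi>B swap_spot spotX by (simp add: S_def \<sigma>_def old_def)
  have \<phi>_y: "\<phi> e (i, y i) = (0, \<psi> 0 e (spot i))" if "e \<in> B" "i \<in> hooked e" for e i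
    using that \<phi>B swap_y y by (simp add: S_def \<sigma>_def old_def)
  have \<phi>_other: "\<phi> e (j, x) = (j, \<psi> j e x)"
    if "e \<in> B" "x \<in> X j" "\<And>i. i \<in> hooked e \<Longrightarrow> (j, x) \<noteq> (0, spot i)"
      "\<And>i. i \<in> hooked e \<Longrightarrow> (j, x) \<noteq> (i, y i)" for e j x
    using that \<phi>B swap_other[of e "(j, x)"] by (simp add: S_def \<sigma>_def old_def)

  \<comment> \<open>The exchanged edge of \<open>X i\<close> starts outside \<open>D i\<close>.\<close>
  have in_D: "\<phi> e (i, x) = (i, \<psi> i e x)" if "e \<in> B" "x \<in> D i" "0 < i" for e i x
    by (rule \<phi>_other) (use that y DX in auto)
  have words_D: "\<phi> (word_value G w) (i, p i) = (i, \<psi> i (word_value G w) (p i))"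
    if "set w \<subseteq> B \<times> UNIV" "length w \<le> r i" and i: "0 < i" for w i
    using that(1,2)
  proof (induction w rule: rev_induct)
    case Nil
    then show ?case using N.act_one[of "(i, p i)"] A.act_one p by (simp add: S_def)
  next
    case (snoc l w)
    obtain e s where l: "l = (e, s)" "e \<in> B" using snoc.prems by (cases l) auto
    have w: "set w \<subseteq> B \<times> UNIV" "length w \<le> r i" using snoc.prems by auto
    note wc = word_closed[OF w(1)] and ec = basis_closed[OF l(2)]
    have lc: "letter_value G l \<in> carrier G" using letter_closed[OF l(2)] l(1) by simp
    define x where "x = \<psi> i (word_value G w) (p i)"
    define x' where "x' = \<psi> i (letter_value G l) x"
    have wl: "word_value G (w @ [l]) = word_value G w \<otimes> letter_value G l"
      using word_append[OF w(1), of "[l]"] l lc by auto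
    have x': "x' = \<psi> i (word_value G (w @ [l])) (p i)"
      unfolding x'_def x_def wl using A.act_mult[OF wc lc p] by simp
    have xD: "x \<in> D i" "x' \<in> D i"
      using w snoc.prems unfolding x_def x' D_def by blast+
    have xX: "x \<in> X i" "x' \<in> X i" using xD DX by blast+
    have step: "\<phi> (letter_value G l) (i, x) = (i, x')"
    proof (cases s)
      case True
      then show ?thesis using in_D[OF l(2) xD(1) i] l by (simp add: x'_def letter_value_def)
    next
      case False
      then have "x' = \<psi> i (inv e) x" using l by (simp add: x'_def letter_value_def)
      then have "\<phi> e (i, x') = (i, x)"
        using in_D[OF l(2) xD(2) i] A.act_act_inv[OF ec xX(1)] by simp
      then have "\<phi> (inv e) (i, x) = (i, x')"
        using N.act_inv_act[OF ec, of "(i, x')"] xX by (simp add: S_def)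
      then show ?thesis using l False by (simp add: letter_value_def)
    qed
    have "\<phi> (word_value G (w @ [l])) (i, p i) = \<phi> (letter_value G l) (i, x)"
      using N.act_mult[OF wc lc, of "(i, p i)"] p snoc.IH[OF w] by (simp add: S_def wl x_def)
    then show ?case using step x' by simp
  qed

  have S0: "(0, p 0) \<in> S" using p by (simp add: S_def)
  have on_ray: "\<phi> (word_value G (ray n)) (0, p 0) = (0, \<psi> 0 (word_value G (ray n)) (p 0))" for n
  proof (induction n)
    case 0
    then show ?case using N.act_one[OF S0] A.act_one[OF p] by (simp add: ray_def)
  next
    case (Suc n)
    note rc = word_closed[OF rayB[of n]] and ac = basis_closed[OF ab(1)]
    have "ray (Suc n) = ray n @ [(a, True)]"
      by (simp add: ray_def replicate_append_same)
    then have val: "word_value G (ray (Suc n)) = word_value G (ray n) \<otimes> a"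
      using word_append[OF rayB[of n], of "[(a, True)]"] ab word_value_letter[OF is_group ac] by simp
    have "\<phi> a (0, \<psi> 0 (word_value G (ray n)) (p 0))
        = (0, \<psi> 0 a (\<psi> 0 (word_value G (ray n)) (p 0)))"
      by (rule \<phi>_other) (use ab ray_spot A.act_closed[OF rc p] in \<open>auto simp: hooked_def\<close>)
    then show ?case
      using Suc N.act_mult[OF rc ac S0] A.act_mult[OF rc ac p] by (simp add: val)
  qed
  have to_spot: "\<phi> (word_value G (branch n)) (0, p 0) = (0, spot n)" for n
  proof -
    note rc = word_closed[OF rayB[of n]] and bc = basis_closed[OF ab(2)]
    have val: "word_value G (branch n) = word_value G (ray n) \<otimes> b"
      using word_append[OF rayB[of n], of "[(b, True)]"] ab word_value_letter[OF is_group bc]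
      by (simp add: branch_def)
    have "\<phi> b (0, \<psi> 0 (word_value G (ray n)) (p 0))
        = (0, \<psi> 0 b (\<psi> 0 (word_value G (ray n)) (p 0)))"
      by (rule \<phi>_other) (use ab ray_spot A.act_closed[OF rc p] in \<open>auto simp: hooked_def\<close>)
    then show ?thesis
      using on_ray N.act_mult[OF rc bc S0] A.act_mult[OF rc bc p] by (simp add: val spot_def)
  qed
  have reach: "\<exists>g\<in>carrier G. \<phi> g (0, p 0) = (i, p i)" if i: "0 < i" for i
  proof -
    have ci: "c i \<in> carrier G" using basis_closed c by blast
    have bi: "word_value G (branch i) \<in> carrier G" using word_closed[OF branchB] .
    obtain w where w: "set w \<subseteq> B \<times> UNIV" "length w \<le> r i"
      "\<psi> i (c i) (y i) = \<psi> i (word_value G w) (p i)"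
      using enter[of i] by (auto simp: D_def)
    have wc: "word_value G w \<in> carrier G" using word_closed[OF w(1)] .
    have piS: "(i, p i) \<in> S" using p by (simp add: S_def)
    have "\<phi> (c i) (0, spot i) = (i, \<psi> i (c i) (y i))"
      using \<phi>_spot c i by (simp add: hooked_def)
    also have "\<dots> = \<phi> (word_value G w) (i, p i)"
      using words_D[OF w(1,2) i] w(3) by simp
    finally have "\<phi> (word_value G (branch i) \<otimes> c i) (0, p 0) = \<phi> (word_value G w) (i, p i)"
      using N.act_mult[OF bi ci S0] to_spot by simp
    then have "\<phi> (word_value G (branch i) \<otimes> c i \<otimes> inv (word_value G w)) (0, p 0) = (i, p i)"
      using N.act_mult[OF m_closed[OF bi ci] inv_closed[OF wc] S0] N.act_inv_act[OF wc piS] by simp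
    then show ?thesis using bi ci wc by blast
  qed

  have "2 * card (inner_edges \<phi> B Z) \<le> 3 * card Z" if Z: "finite Z" "Z \<subseteq> S" for Z
  proof -
    define I where "I = fst ` Z"
    define piece where "piece i = {x. (i, x) \<in> Z}" for i
    have fin: "finite I" "finite (piece i)" for i
      using Z finite_vimageI[of Z "Pair i"] by (auto simp: I_def piece_def vimage_def inj_on_def)
    have Zsum: "card Z = (\<Sum>i\<in>I. card (piece i))"
    proof -
      have "Z = Sigma I piece" by (force simp: I_def piece_def)
      then show ?thesis using card_SigmaI[OF fin(1)] fin(2) by metis
    qed
    \<comment> \<open>An edge is identified with its starting point and label. The edges in \<open>kept\<close> end in \<open>Z\<close> under
      the original action; those with another end after the exchange are harmlessly included.\<close>
    define kept where "kept = {(q, e). q \<in> Z \<and> e \<in> B \<and> old e q \<in> Z}"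
    have finK: "finite kept"
      by (rule finite_subset[of _ "Z \<times> B"]) (use Z finite_basis in \<open>auto simp: kept_def\<close>)
    have "kept \<subseteq> (\<Union>i\<in>I. (\<lambda>(x, e). ((i, x), e)) ` inner_edges (\<psi> i) B (piece i))"
      by (force simp: kept_def old_def I_def piece_def inner_edges_def)
    then have "card kept
        \<le> card (\<Union>i\<in>I. (\<lambda>(x, e). ((i, x), e)) ` inner_edges (\<psi> i) B (piece i))"
      by (rule card_mono[rotated])
        (intro finite_UN_I finite_imageI finite_inner_edges fin finite_basis)
    also have "\<dots> \<le> (\<Sum>i\<in>I. card ((\<lambda>(x, e). ((i, x), e)) ` inner_edges (\<psi> i) B (piece i)))"
      by (rule card_UN_le[OF fin(1)])
    also have "\<dots> \<le> (\<Sum>i\<in>I. card (inner_edges (\<psi> i) B (piece i)))"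
      by (intro sum_mono card_image_le finite_inner_edges fin finite_basis)
    finally have kept: "card kept \<le> (\<Sum>i\<in>I. card (inner_edges (\<psi> i) B (piece i)))" .

    define fresh where "fresh = inner_edges \<phi> B Z - kept"
    \<comment> \<open>The index \<open>i\<close> of the exchange from which a fresh edge arises.\<close>
    define hook where "hook = (\<lambda>((j, x), e :: 'a). if j = 0 then the_inv spot x else j)"
    have fresh: "\<exists>i. i \<in> hooked e \<and> i \<in> I \<and> hook (q, e) = i \<and>
        (q = (0, spot i) \<or> q = (i, y i) \<and> (0, \<psi> 0 e (spot i)) \<in> Z)"
      if qe: "(q, e) \<in> fresh" for q e
    proof -
      have q: "q \<in> Z" "e \<in> B" "\<phi> e q \<in> Z" "old e q \<notin> Z"
        using qe by (auto simp: fresh_def inner_edges_def kept_def)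
      obtain j x where jx: "q = (j, x)" "x \<in> X j" using q Z by (cases q) (auto simp: S_def)
      have "\<not> ((\<forall>i\<in>hooked e. q \<noteq> (0, spot i)) \<and> (\<forall>i\<in>hooked e. q \<noteq> (i, y i)))"
      proof
        assume "(\<forall>i\<in>hooked e. q \<noteq> (0, spot i)) \<and> (\<forall>i\<in>hooked e. q \<noteq> (i, y i))"
        then have "\<phi> e q = old e q"
          using \<phi>_other[OF q(2) jx(2)] unfolding jx(1) old_def prod.case by blast
        then show False using q by simp
      qed
      then obtain i where i: "i \<in> hooked e" "q = (0, spot i) \<or> q = (i, y i)" by blast
      then show ?thesis
      proof (elim disjE)
        assume "q = (0, spot i)"
        moreover have "i \<in> I" using \<phi>_spot[OF q(2) i(1)] q \<open>q = (0, spot i)\<close> by (force simp: I_def)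
        ultimately show ?thesis using i the_inv_f_f[OF inj_spot] by (auto simp: hook_def)
      next
        assume qy: "q = (i, y i)"
        moreover have "i \<in> I" using q qy by (force simp: I_def)
        moreover have "(0, \<psi> 0 e (spot i)) \<in> Z" using \<phi>_y[OF q(2) i(1)] q qy by simp
        ultimately show ?thesis using i by (auto simp: hook_def hooked_def)
      qed
    qed
    have "inj_on hook fresh"
    proof (rule inj_onI)
      fix f f' assume ff: "f \<in> fresh" "f' \<in> fresh" "hook f = hook f'"
      obtain j x e j' x' e' where fe: "f = ((j, x), e)" "f' = ((j', x'), e')"
        by (metis prod.exhaust)
      have f: "((j, x), e) \<in> fresh" "((j', x'), e') \<in> fresh"
        and eq: "hook ((j, x), e) = hook ((j', x'), e')"
        using ff unfolding fe by auto
      obtain i where i: "i \<in> hooked e" "hook ((j, x), e) = i"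
        "(j, x) = (0, spot i) \<or> (j, x) = (i, y i) \<and> (0, \<psi> 0 e (spot i)) \<in> Z"
        using fresh[OF f(1)] by auto
      obtain i' where i': "i' \<in> hooked e'" "hook ((j', x'), e') = i'"
        "(j', x') = (0, spot i') \<or> (j', x') = (i', y i') \<and> (0, \<psi> 0 e' (spot i')) \<in> Z"
        using fresh[OF f(2)] by auto
      have ii: "i' = i" "e' = e" using i i' eq by (auto simp: hooked_def)
      have mixed: False if "((0, spot i), e) \<in> fresh" "(0, \<psi> 0 e (spot i)) \<in> Z"
        using that by (auto simp: fresh_def kept_def inner_edges_def old_def)
      show "f = f'"
        using i(3) i'(3) f mixed unfolding fe ii by auto
    qed
    moreover have "hook ` fresh \<subseteq> I"
      using fresh by (force simp: image_subset_iff)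
    ultimately have "card fresh \<le> card I"
      using fin(1) by (metis card_inj_on_le)
    moreover have "card (inner_edges \<phi> B Z) \<le> card kept + card fresh"
    proof -
      have "inner_edges \<phi> B Z \<subseteq> kept \<union> fresh" by (auto simp: fresh_def)
      moreover have "finite (kept \<union> fresh)"
        using finK finite_inner_edges[OF Z(1) finite_basis] by (auto simp: fresh_def)
      ultimately show ?thesis by (meson card_Un_le card_mono order_trans)
    qed
    moreover have "(\<Sum>i\<in>I. 2 * card (inner_edges (\<psi> i) B (piece i)) + 2)
        = 2 * (\<Sum>i\<in>I. card (inner_edges (\<psi> i) B (piece i))) + 2 * card I"
      by (simp only: sum.distrib sum_distrib_left sum_constant) simp
    ultimately have "2 * card (inner_edges \<phi> B Z)
        \<le> (\<Sum>i\<in>I. 2 * card (inner_edges (\<psi> i) B (piece i)) + 2)"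
      using kept by linarith
    also have "\<dots> \<le> (\<Sum>i\<in>I. 3 * card (piece i))"
    proof (rule sum_mono)
      fix i assume "i \<in> I"
      then have "piece i \<noteq> {}" by (auto simp: I_def piece_def)
      moreover have "piece i \<subseteq> X i" using Z by (auto simp: piece_def S_def)
      ultimately show "2 * card (inner_edges (\<psi> i) B (piece i)) + 2 \<le> 3 * card (piece i)"
        using sp[of i] fin(2)[of i] unfolding strictly_sparse_def by blast
    qed
    also have "\<dots> = 3 * card Z" by (simp add: Zsum sum_distrib_left)
    finally show ?thesis .
  qed
  then have "sparse \<phi> B S" by (simp add: sparse_def)
  then show ?thesis using \<phi> words_D reach unfolding S_def by blast
qed

end

section \<open>A faithful transitive sparse action with many fixed points\<close>

lemma (in right_action) orbit_on_nat:
  assumes q: "q \<in> S" and cnt: "countable (carrier G)"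
  defines "Orb \<equiv> {\<phi> g q | g. g \<in> carrier G}"
  shows "\<exists>(S' :: nat set) \<phi>' f. right_action G S' \<phi>' \<and> bij_betw f Orb S' \<and>
           (\<forall>g\<in>carrier G. \<forall>x\<in>Orb. \<phi>' g (f x) = f (\<phi> g x))"
proof -
  have OrbS: "Orb \<subseteq> S" using act_closed q by (auto simp: Orb_def)
  have act_Orb: "\<phi> g x \<in> Orb" if "g \<in> carrier G" "x \<in> Orb" for g x
  proof -
    obtain h where h: "h \<in> carrier G" "x = \<phi> h q" using \<open>x \<in> Orb\<close> by (auto simp: Orb_def)
    then have "\<phi> g x = \<phi> (h \<otimes> g) q" using act_mult[OF h(1) that(1) q] by simp
    then show ?thesis using h that(1) by (auto simp: Orb_def)
  qed
  have "Orb = (\<lambda>g. \<phi> g q) ` carrier G" by (auto simp: Orb_def)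
  then have "countable Orb" using cnt by simp
  then obtain f :: "'c \<Rightarrow> nat" where f: "inj_on f Orb" by (auto simp: countable_def)
  define u where "u = inv_into Orb f"
  have u: "u (f x) = x" if "x \<in> Orb" for x using f that by (simp add: u_def)
  have "right_action G (f ` Orb) (\<lambda>g. restrict (\<lambda>n. f (\<phi> g (u n))) (f ` Orb))"
  proof (rule right_action_restrict[OF is_group])
    show "f (\<phi> g (u n)) \<in> f ` Orb" if "g \<in> carrier G" "n \<in> f ` Orb" for g n
      using that act_Orb u by auto
    show "f (\<phi> \<one> (u n)) = n" if "n \<in> f ` Orb" for n
      using that act_one u OrbS by auto
    show "f (\<phi> (g \<otimes> h) (u n)) = f (\<phi> h (u (f (\<phi> g (u n)))))"
      if "g \<in> carrier G" "h \<in> carrier G" "n \<in> f ` Orb" for g h n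
    proof -
      obtain x where x: "x \<in> Orb" "n = f x" using \<open>n \<in> f ` Orb\<close> by auto
      then have "x \<in> S" using OrbS by auto
      then show ?thesis
        using x u act_Orb[OF that(1) x(1)] act_mult[OF that(1,2)] by simp
    qed
  qed
  moreover have "bij_betw f Orb (f ` Orb)" using f by (simp add: bij_betw_def)
  ultimately show ?thesis using u by force
qed

lemma sparse_transport:
  assumes sp: "sparse \<phi> B S" and f: "bij_betw f S' T" and "S' \<subseteq> S"
    and eqv: "\<And>b x. b \<in> B \<Longrightarrow> x \<in> S' \<Longrightarrow> \<phi> b x \<in> S' \<and> \<phi>' b (f x) = f (\<phi> b x)"
    and B: "finite B"
  shows "sparse \<phi>' B T"
  unfolding sparse_def
proof (intro allI impI)
  fix Z assume Z: "finite Z" "Z \<subseteq> T"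
  define W where "W = {x \<in> S'. f x \<in> Z}"
  have inj: "inj_on f S'" using f by (simp add: bij_betw_def)
  have Zf: "Z = f ` W" using f Z(2) by (auto simp: W_def bij_betw_def)
  have injW: "inj_on f W" by (rule inj_on_subset[OF inj]) (auto simp: W_def)
  have W: "finite W" "card W = card Z" "W \<subseteq> S"
    using Zf Z(1) finite_image_iff[OF injW] card_image[OF injW] assms(3) by (auto simp: W_def)
  have "inner_edges \<phi>' B Z \<subseteq> (\<lambda>(x, b). (f x, b)) ` inner_edges \<phi> B W"
  proof clarify
    fix z b assume "(z, b) \<in> inner_edges \<phi>' B Z"
    then have zb: "z \<in> Z" "b \<in> B" "\<phi>' b z \<in> Z" by (auto simp: inner_edges_def)
    obtain x where xW: "x \<in> W" "z = f x" using zb(1) unfolding Zf by blast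
    then have x: "x \<in> S'" "z = f x" "x \<in> W" by (simp_all add: W_def)
    then have "\<phi> b x \<in> W" using eqv[OF zb(2) x(1)] zb(3) by (simp add: W_def)
    then have "(x, b) \<in> inner_edges \<phi> B W" using x zb by (simp add: inner_edges_def)
    then show "(z, b) \<in> (\<lambda>(x, b). (f x, b)) ` inner_edges \<phi> B W" using x by force
  qed
  then have "card (inner_edges \<phi>' B Z) \<le> card (inner_edges \<phi> B W)"
    using finite_inner_edges[OF W(1) B] by (rule surj_card_le[rotated])
  moreover have "2 * card (inner_edges \<phi> B W) \<le> 3 * card W"
    using sp W(1,3) unfolding sparse_def by blast
  ultimately show "2 * card (inner_edges \<phi>' B Z) \<le> 3 * card Z" using W(2) by linarith
qed

context finite_free_basis
begin

lemma countable_carrier: "countable (carrier G)"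
proof -
  have "countable {w. set w \<subseteq> B \<times> (UNIV :: bool set)}"
    using countable_lists[of "B \<times> (UNIV :: bool set)"] finite_basis
    by (simp add: countable_finite lists_eq_set)
  then have "countable (word_value G ` {w. set w \<subseteq> B \<times> UNIV})" by simp
  moreover have "carrier G \<subseteq> word_value G ` {w. set w \<subseteq> B \<times> UNIV}"
    using word_exists reduced_words_subset by (force simp: image_iff)
  ultimately show ?thesis by (rule countable_subset[rotated])
qed

text \<open>
  A task is a finite set \<open>T\<close> of elements of some \<open>K k\<close> with a radius. It is handled by the cosets of
  the subgroup \<open>H\<close> generated by \<open>T\<close>, in which the coset \<open>H\<close> itself is a fixed point of \<open>T\<close>. The radius
  has to be large enough for the paths along the elements of \<open>T\<close>, so that the point stays fixed after
  gluing. The tasks with \<open>T = {}\<close> contain arbitrarily large balls of the Cayley graph and make the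
  action faithful. There are only countably many tasks, and \<open>task 0\<close> serves as the free base.
\<close>

lemma sparse_action_with_fixed_points:
  assumes rank: "2 \<le> card B"
    and K: "\<And>k. K k \<lhd> G"
    and short: "\<And>k w. w \<in> reduced_words B \<Longrightarrow> length w \<le> 2 * k + 2 \<Longrightarrow> word_value G w \<in> K k \<Longrightarrow> w = []"
  shows "\<exists>(S :: nat set) \<phi>. right_action G S \<phi> \<and> S \<noteq> {} \<and> sparse \<phi> B S \<and>
     (\<forall>x\<in>S. \<forall>y\<in>S. \<exists>g\<in>carrier G. \<phi> g x = y) \<and>
     inj_on \<phi> (carrier G) \<and>
     (\<forall>k T. finite T \<longrightarrow> card T \<le> k \<longrightarrow> T \<subseteq> K k \<longrightarrow> (\<exists>x\<in>S. \<forall>t\<in>T. \<phi> t x = x))"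
proof -
  have KG: "K k \<subseteq> carrier G" for k
    using K normal_imp_subgroup subgroup.subset by blast
  define tasks :: "('a set \<times> nat) set"
    where "tasks = {T. finite T \<and> (\<exists>k. card T \<le> k \<and> T \<subseteq> K k)} \<times> UNIV"
  have "{T. finite T \<and> (\<exists>k. card T \<le> k \<and> T \<subseteq> K k)} \<subseteq> {T. finite T \<and> T \<subseteq> carrier G}"
    using KG by blast
  then have cnt: "countable tasks"
    unfolding tasks_def using countable_Collect_finite_subset[OF countable_carrier]
    by (intro countable_SIGMA) (auto intro: countable_subset)
  have trivial_task: "({}, n) \<in> tasks" for n by (auto simp: tasks_def)
  define task where "task i = (case i of 0 \<Rightarrow> ({}, 0) | Suc j \<Rightarrow> from_nat_into tasks j)" for i
  have task: "task i \<in> tasks" for i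
    using trivial_task from_nat_into[of tasks] by (auto simp: task_def split: nat.split)
  have task_surj: "\<exists>i>0. task i = t" if "t \<in> tasks" for t
  proof -
    have "t \<in> range (from_nat_into tasks)"
      using range_from_nat_into[of tasks] cnt that by blast
    then obtain j where "from_nat_into tasks j = t" by auto
    then show ?thesis by (intro exI[of _ "Suc j"]) (simp add: task_def)
  qed
  define H where "H i = generate G (fst (task i))" for i
  have sub: "fst (task i) \<subseteq> carrier G" for i
    using task[of i] KG unfolding tasks_def by (auto simp: mem_Times_iff)
  have H: "subgroup (H i) G" for i
    using generate_is_subgroup[OF sub] by (simp add: H_def)
  define p where "p i = H i" for i
  have p: "p i \<in> rcosets (H i)" for i
    using subgroup.subgroup_in_rcosets[OF H is_group] by (simp add: p_def)
  have fixed: "coset_action G (H i) g (p i) = p i \<longleftrightarrow> g \<in> H i" if "g \<in> carrier G" for g i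
    using p[of i] coset_fixed_iff[OF H that] by (simp add: p_def)
  have sp: "strictly_sparse (coset_action G (H i)) B (rcosets (H i))" for i
  proof -
    obtain k where T: "finite (fst (task i))" "card (fst (task i)) \<le> k" "fst (task i) \<subseteq> K k"
      using task[of i] unfolding tasks_def by (auto simp: mem_Times_iff)
    show ?thesis
      unfolding H_def by (rule coset_action_strictly_sparse[OF K short T(1,3,2)])
  qed
  have H0: "g = \<one>" if "g \<in> carrier G" "coset_action G (H 0) g (p 0) = p 0" for g
  proof -
    have "g \<in> H 0" using fixed[OF that(1), of 0] that(2) by blast
    then show ?thesis using generate_empty by (simp add: H_def task_def)
  qed
  have "\<exists>\<phi>. right_action G (SIGMA i:UNIV. rcosets (H i)) \<phi> \<and>
      sparse \<phi> B (SIGMA i:UNIV. rcosets (H i)) \<and>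
      (\<forall>i>0. \<exists>g\<in>carrier G. \<phi> g (0, p 0) = (i, p i)) \<and>
      (\<forall>i>0. \<forall>w. set w \<subseteq> B \<times> UNIV \<longrightarrow> length w \<le> snd (task i) \<longrightarrow>
        \<phi> (word_value G w) (i, p i) = (i, coset_action G (H i) (word_value G w) (p i)))"
    by (rule glue_along_free_orbit[OF rank]; (rule coset_right_action[OF H] sp p H0; assumption?))
  then obtain \<phi> where \<phi>: "right_action G (SIGMA i:UNIV. rcosets (H i)) \<phi>"
    and \<phi>sp: "sparse \<phi> B (SIGMA i:UNIV. rcosets (H i))"
    and all_reached: "\<forall>i>0. \<exists>g\<in>carrier G. \<phi> g (0, p 0) = (i, p i)"
    and all_local: "\<forall>i>0. \<forall>w. set w \<subseteq> B \<times> UNIV \<longrightarrow> length w \<le> snd (task i) \<longrightarrow>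
        \<phi> (word_value G w) (i, p i) = (i, coset_action G (H i) (word_value G w) (p i))"
    by (elim exE conjE) (rule that)
  have reach: "\<exists>g\<in>carrier G. \<phi> g (0, p 0) = (i, p i)" if "0 < i" for i
    using all_reached that by (elim allE impE)
  have local: "\<phi> (word_value G w) (i, p i) = (i, coset_action G (H i) (word_value G w) (p i))"
    if "0 < i" "set w \<subseteq> B \<times> UNIV" "length w \<le> snd (task i)" for i w
    using all_local that by (elim allE impE)
  interpret N: right_action G "SIGMA i:UNIV. rcosets (H i)" \<phi> by (rule \<phi>)
  define Orb where "Orb = {\<phi> g (0, p 0) | g. g \<in> carrier G}"
  have base: "(0, p 0) \<in> (SIGMA i:UNIV. rcosets (H i))" using p by simp
  have OrbS: "Orb \<subseteq> (SIGMA i:UNIV. rcosets (H i))"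
    using N.act_closed[OF _ base] unfolding Orb_def by blast
  have pO: "(i, p i) \<in> Orb" if "0 < i" for i
    using reach[OF that] by (force simp: Orb_def)
  have act_Orb: "\<phi> g x \<in> Orb" if "g \<in> carrier G" "x \<in> Orb" for g x
  proof -
    obtain h where h: "h \<in> carrier G" "x = \<phi> h (0, p 0)" using \<open>x \<in> Orb\<close> by (auto simp: Orb_def)
    then have "\<phi> g x = \<phi> (h \<otimes> g) (0, p 0)" using N.act_mult[OF h(1) that(1) base] by simp
    then show ?thesis using h that(1) by (auto simp: Orb_def)
  qed
  obtain S :: "nat set" and \<phi>' f where \<phi>': "right_action G S \<phi>'" and f: "bij_betw f Orb S"
    and eqv: "\<And>g x. g \<in> carrier G \<Longrightarrow> x \<in> Orb \<Longrightarrow> \<phi>' g (f x) = f (\<phi> g x)"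
    using N.orbit_on_nat[OF base countable_carrier] unfolding Orb_def by blast
  interpret R: right_action G S \<phi>' by (rule \<phi>')
  have Sf: "S = f ` Orb" and finj: "inj_on f Orb" using f by (auto simp: bij_betw_def)
  have word: "\<exists>w. set w \<subseteq> B \<times> UNIV \<and> word_value G w = g" if "g \<in> carrier G" for g
    using word_exists[OF that] reduced_words_subset by blast

  have "sparse \<phi>' B S"
    by (rule sparse_transport[OF \<phi>sp f OrbS]) (use eqv act_Orb basis_closed finite_basis in auto)
  moreover have "\<exists>g\<in>carrier G. \<phi>' g x = y" if xy: "x \<in> S" "y \<in> S" for x y
  proof -
    obtain u v where uv: "u \<in> Orb" "x = f u" "v \<in> Orb" "y = f v"
      using xy unfolding Sf by (elim imageE)
    obtain g where g: "g \<in> carrier G" "u = \<phi> g (0, p 0)"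
      using uv(1) unfolding Orb_def by (elim CollectE exE conjE)
    obtain h where h: "h \<in> carrier G" "v = \<phi> h (0, p 0)"
      using uv(3) unfolding Orb_def by (elim CollectE exE conjE)
    have gh: "g \<in> carrier G" "x = f (\<phi> g (0, p 0))" "h \<in> carrier G" "y = f (\<phi> h (0, p 0))"
      using uv g h by simp_all
    have in_Orb: "\<phi> g (0, p 0) \<in> Orb" using gh by (auto simp: Orb_def)
    have "\<phi> (inv g \<otimes> h) (\<phi> g (0, p 0)) = \<phi> h (\<phi> (inv g) (\<phi> g (0, p 0)))"
      by (rule N.act_mult[OF inv_closed[OF gh(1)] gh(3)]) (use in_Orb OrbS in blast)
    also have "\<dots> = \<phi> h (0, p 0)" using N.act_inv_act[OF gh(1) base] by simp
    finally have "\<phi>' (inv g \<otimes> h) x = y" using eqv[OF _ in_Orb] gh by simp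
    then show ?thesis using gh by blast
  qed
  moreover have "inj_on \<phi>' (carrier G)"
  proof (rule inj_onI)
    fix g h assume gh: "g \<in> carrier G" "h \<in> carrier G" "\<phi>' g = \<phi>' h"
    define k where "k = g \<otimes> inv h"
    have k: "k \<in> carrier G" using gh by (simp add: k_def)
    obtain w where w: "set w \<subseteq> B \<times> UNIV" "word_value G w = k" using word[OF k] by blast
    obtain i where i: "0 < i" "task i = ({}, length w)" using task_surj[OF trivial_task] by blast
    have x: "f (i, p i) \<in> S" using pO[OF i(1)] by (simp add: Sf)
    have "\<phi>' k (f (i, p i)) = \<phi>' (inv h) (\<phi>' g (f (i, p i)))"
      unfolding k_def by (rule R.act_mult[OF gh(1) inv_closed[OF gh(2)] x])
    also have "\<dots> = f (i, p i)"
      unfolding gh(3) by (rule R.act_inv_act[OF gh(2) x])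
    finally have "f (\<phi> k (i, p i)) = f (i, p i)"
      unfolding eqv[OF k pO[OF i(1)]] .
    then have "\<phi> k (i, p i) = (i, p i)"
      by (rule inj_onD[OF finj _ act_Orb[OF k pO[OF i(1)]] pO[OF i(1)]])
    moreover have "\<phi> k (i, p i) = (i, coset_action G (H i) k (p i))"
      using local[OF i(1) w(1)] unfolding i(2) w(2) snd_conv by blast
    ultimately have "coset_action G (H i) k (p i) = p i" by (metis prod.inject)
    then have "k \<in> H i" using fixed[OF k, of i] by blast
    then have "k = \<one>" using generate_empty unfolding H_def i(2) by simp
    then show "g = h" using gh by (metis inv_closed inv_equality inv_inv k_def)
  qed
  moreover have "\<exists>x\<in>S. \<forall>t\<in>T. \<phi>' t x = x" if T: "finite T" "card T \<le> k" "T \<subseteq> K k" for k T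
  proof -
    have TG: "T \<subseteq> carrier G" using T(3) KG[of k] by blast
    have "\<forall>t\<in>T. \<exists>w. set w \<subseteq> B \<times> UNIV \<and> word_value G w = t" using word TG by blast
    then obtain w where w: "\<And>t. t \<in> T \<Longrightarrow> set (w t) \<subseteq> B \<times> UNIV \<and> word_value G (w t) = t" by metis
    define n where "n = Max (insert 0 ((length \<circ> w) ` T))"
    have n: "length (w t) \<le> n" if "t \<in> T" for t
      unfolding n_def using T(1) that by (intro Max_ge) auto
    have "(T, n) \<in> tasks" using T unfolding tasks_def by blast
    then obtain i where i: "0 < i" "task i = (T, n)"
      using task_surj by blast
    have "\<phi>' t (f (i, p i)) = f (i, p i)" if t: "t \<in> T" for t
    proof -
      have tG: "t \<in> carrier G" using t TG by blast
      have "t \<in> H i" unfolding H_def i(2) fst_conv using t by (rule generate.incl)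
      then have "coset_action G (H i) t (p i) = p i" using fixed[OF tG, of i] by blast
      moreover have "\<phi> t (i, p i) = (i, coset_action G (H i) t (p i))"
        using local[OF i(1), of "w t"] w[OF t] n[OF t] unfolding i(2) snd_conv by metis
      ultimately have "\<phi> t (i, p i) = (i, p i)" by metis
      then show ?thesis unfolding eqv[OF tG pO[OF i(1)]] by (rule arg_cong)
    qed
    then show ?thesis using pO[OF i(1)] unfolding Sf by blast
  qed
  moreover have "S \<noteq> {}" using pO[OF zero_less_one] unfolding Sf by blast
  ultimately show ?thesis using \<phi>' by blast
qed

end

section \<open>Tarski numbers of sparse actions with many fixed points\<close>

lemma paradoxical_decomposition_swap:
  assumes "paradoxical_decomposition G S \<phi> m n P Q g h"
  shows "paradoxical_decomposition G S \<phi> n m Q P h g"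
proof -
  note dec = assms[unfolded paradoxical_decomposition_def]
  have "\<forall>i<m. \<forall>j<n. P i \<inter> Q j = {}" using dec by (elim conjE)
  then have "\<forall>j<n. \<forall>i<m. Q j \<inter> P i = {}" by (simp add: Int_commute)
  with dec show ?thesis
    unfolding paradoxical_decomposition_def by (elim conjE) (intro conjI)
qed

lemma paradoxical_decompositionD:
  assumes "paradoxical_decomposition G S \<phi> m n P Q g h"
  shows "i < m \<Longrightarrow> P i \<subseteq> S" "i < m \<Longrightarrow> g i \<in> carrier G"
    and "j < n \<Longrightarrow> Q j \<subseteq> S" "j < n \<Longrightarrow> h j \<in> carrier G"
    and "i < m \<Longrightarrow> j < n \<Longrightarrow> P i \<inter> Q j = {}"
    and "i < m \<Longrightarrow> k < m \<Longrightarrow> i \<noteq> k \<Longrightarrow> P i \<inter> P k = {}"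
    and "S = (\<Union>i<m. \<phi> (g i) ` P i)" "S = (\<Union>j<n. \<phi> (h j) ` Q j)"
proof -
  note dec = assms[unfolded paradoxical_decomposition_def]
  have P: "\<forall>i<m. P i \<subseteq> S \<and> g i \<in> carrier G" using dec by (elim conjE)
  have Q: "\<forall>j<n. Q j \<subseteq> S \<and> h j \<in> carrier G" using dec by (elim conjE)
  have PQ: "\<forall>i<m. \<forall>j<n. P i \<inter> Q j = {}" using dec by (elim conjE)
  have PP: "disjoint_family_on P {..<m}" using dec by (elim conjE)
  show "i < m \<Longrightarrow> P i \<subseteq> S" "i < m \<Longrightarrow> g i \<in> carrier G" using P by simp_all
  show "j < n \<Longrightarrow> Q j \<subseteq> S" "j < n \<Longrightarrow> h j \<in> carrier G" using Q by simp_all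
  show "i < m \<Longrightarrow> j < n \<Longrightarrow> P i \<inter> Q j = {}" using PQ by simp
  show "i < m \<Longrightarrow> k < m \<Longrightarrow> i \<noteq> k \<Longrightarrow> P i \<inter> P k = {}"
    using PP by (simp add: disjoint_family_on_def)
  show "S = (\<Union>i<m. \<phi> (g i) ` P i)" using dec by (elim conjE)
  show "S = (\<Union>j<n. \<phi> (h j) ` Q j)" using dec by (elim conjE)
qed

lemma tarski_number_ge:
  assumes "\<And>m n P Q g h. paradoxical_decomposition G S \<phi> m n P Q g h \<Longrightarrow> k \<le> m + n"
  shows "enat k \<le> tarski_number G S \<phi>"
  unfolding tarski_number_def by (rule Inf_greatest) (use assms in auto)

lemma tarski_number_le:
  assumes "paradoxical_decomposition G S \<phi> m n P Q g h"
  shows "tarski_number G S \<phi> \<le> enat (m + n)"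
  unfolding tarski_number_def by (rule Inf_lower) (use assms in blast)

context right_action
begin

lemma pieces_cover:
  assumes dec: "paradoxical_decomposition (G\<lparr>carrier := K\<rparr>) S \<phi> m n P Q g h"
    and x: "x \<in> S"
  shows "\<exists>i<m. \<exists>y\<in>P i. \<phi> (g i) y = x" "\<exists>j<n. \<exists>y\<in>Q j. \<phi> (h j) y = x"
proof -
  obtain i where i: "i < m" "x \<in> \<phi> (g i) ` P i"
    using x paradoxical_decompositionD(7)[OF dec] by blast
  then obtain y where "y \<in> P i" "\<phi> (g i) y = x" by blast
  with i(1) show "\<exists>i<m. \<exists>y\<in>P i. \<phi> (g i) y = x" by blast
  obtain j where j: "j < n" "x \<in> \<phi> (h j) ` Q j"
    using x paradoxical_decompositionD(8)[OF dec] by blast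
  then obtain z where "z \<in> Q j" "\<phi> (h j) z = x" by blast
  with j(1) show "\<exists>j<n. \<exists>y\<in>Q j. \<phi> (h j) y = x" by blast
qed

lemma no_paradox_with_common_fixed_point:
  assumes K: "K \<subseteq> carrier G"
    and dec: "paradoxical_decomposition (G\<lparr>carrier := K\<rparr>) S \<phi> m n P Q g h"
    and x: "x \<in> S" "\<And>i. i < m \<Longrightarrow> \<phi> (g i) x = x" "\<And>j. j < n \<Longrightarrow> \<phi> (h j) x = x"
  shows False
proof -
  obtain i y where i: "i < m" "y \<in> P i" "\<phi> (g i) y = x"
    using pieces_cover(1)[OF dec x(1)] by blast
  obtain j z where j: "j < n" "z \<in> Q j" "\<phi> (h j) z = x"
    using pieces_cover(2)[OF dec x(1)] by blast
  have "y \<in> S" "z \<in> S" "g i \<in> carrier G" "h j \<in> carrier G"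
    using paradoxical_decompositionD(1,2)[OF dec i(1)] paradoxical_decompositionD(3,4)[OF dec j(1)]
      i(2) j(2) K by auto
  then have "y = x" "z = x"
    using act_inj[of "g i" y x] act_inj[of "h j" z x] i j x by simp_all
  moreover have "P i \<inter> Q j = {}"
    using paradoxical_decompositionD(5)[OF dec i(1) j(1)] .
  ultimately show False using i(2) j(2) by blast
qed

lemma no_paradox_with_one_piece:
  assumes dec: "paradoxical_decomposition G S \<phi> 1 n P Q g h" and "S \<noteq> {}"
  shows False
proof -
  have dec': "paradoxical_decomposition (G\<lparr>carrier := carrier G\<rparr>) S \<phi> 1 n P Q g h"
    using dec by simp
  have PQ: "g 0 \<in> carrier G" "P 0 \<subseteq> S" "\<And>j. j < n \<Longrightarrow> Q j \<subseteq> S" "\<And>j. j < n \<Longrightarrow> P 0 \<inter> Q j = {}"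
    using paradoxical_decompositionD(1-5)[OF dec] by simp_all
  obtain x where "x \<in> S" using assms(2) by blast
  then obtain j y where j: "j < n" "y \<in> Q j"
    using pieces_cover(2)[OF dec'] by blast
  have y: "y \<in> S" using PQ j by blast
  then obtain z where z: "z \<in> P 0" "\<phi> (g 0) z = \<phi> (g 0) y"
    using pieces_cover(1)[OF dec' act_closed[OF PQ(1) y]] by auto
  then have "z = y" using act_inj[OF PQ(1)] PQ y by blast
  then show False using z j PQ by blast
qed

text \<open>
  A point \<open>z\<close> outside \<open>P 0\<close> is moved into \<open>P 1\<close> by \<open>t = g 0 \<otimes> inv (g 1)\<close>, hence again to a point
  outside \<open>P 0\<close>. So all further points of its orbit under \<open>t\<close> lie in \<open>P 1\<close>, and if \<open>z\<close> is periodic, it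
  is one of them.
\<close>

lemma periodic_point_in_pieces:
  assumes P: "P 0 \<subseteq> S" "P (Suc 0) \<subseteq> S" "P 0 \<inter> P (Suc 0) = {}"
    and g: "g 0 \<in> carrier G" "g (Suc 0) \<in> carrier G"
    and cover: "\<And>x. x \<in> S \<Longrightarrow> \<exists>i<2. \<exists>y\<in>P i. \<phi> (g i) y = x"
    and L: "0 < L" and y: "y \<in> S" "\<phi> ((g 0 \<otimes> inv (g (Suc 0))) [^] (L :: nat)) y = y"
  shows "y \<in> P 0 \<union> P (Suc 0)"
proof (rule ccontr)
  assume out: "y \<notin> P 0 \<union> P (Suc 0)"
  define t where "t = g 0 \<otimes> inv (g (Suc 0))"
  have t: "t \<in> carrier G" using g by (simp add: t_def)
  have shift: "\<phi> t z \<in> P (Suc 0)" if z: "z \<in> S" "z \<notin> P 0" for z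
  proof -
    obtain i x where i: "i < 2" "x \<in> P i" "\<phi> (g i) x = \<phi> (g 0) z"
      using cover[OF act_closed[OF g(1) z(1)]] by blast
    have "i \<noteq> 0"
    proof
      assume "i = 0"
      then have "x = z" using act_inj[OF g(1), of x z] i P z by auto
      then show False using i z \<open>i = 0\<close> by simp
    qed
    then have "i = Suc 0" using i(1) by simp
    then have "x \<in> S" "\<phi> (g (Suc 0)) x = \<phi> (g 0) z" "x \<in> P (Suc 0)" using i P by auto
    then have "\<phi> t z = x"
      using act_mult[OF g(1) inv_closed[OF g(2)] z(1)] act_inv_act[OF g(2), of x] by (simp add: t_def)
    then show ?thesis using \<open>x \<in> P (Suc 0)\<close> by simp
  qed
  have "\<phi> (t [^] Suc n) y \<in> P (Suc 0)" for n
  proof (induction n)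
    case 0
    then show ?case using shift[OF y(1)] out t by simp
  next
    case (Suc n)
    then have "\<phi> t (\<phi> (t [^] Suc n) y) \<in> P (Suc 0)" using shift P by blast
    then show ?case using act_mult[OF nat_pow_closed[OF t] t y(1), of "Suc n"] by simp
  qed
  from this[of "L - 1"] show False using L y(2) out by (simp add: t_def)
qed

text \<open>
  A power \<open>t ^ L\<close> of \<open>t = g 0 \<otimes> inv (g 1)\<close> lies in \<open>K\<close>. For a common fixed point \<open>x\<close> of the conjugates
  of \<open>t ^ L\<close> by the at most three \<open>h j\<close>, all preimages of \<open>x\<close> under the \<open>h j\<close> are periodic points of
  \<open>t\<close> and belong to the pieces \<open>P i\<close>. One of them must also belong to a piece \<open>Q j\<close>.
\<close>

lemma no_paradox_with_two_and_three_pieces: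
  assumes K: "K \<lhd> G" "finite (rcosets K)"
    and fixed: "\<And>T. finite T \<Longrightarrow> card T \<le> 3 \<Longrightarrow> T \<subseteq> K \<Longrightarrow> \<exists>x\<in>S. \<forall>t\<in>T. \<phi> t x = x"
    and dec: "paradoxical_decomposition G S \<phi> 2 n P Q g h" and n: "n \<le> 3"
  shows False
proof -
  have dec': "paradoxical_decomposition (G\<lparr>carrier := carrier G\<rparr>) S \<phi> 2 n P Q g h"
    using dec by simp
  have P: "P 0 \<subseteq> S" "P (Suc 0) \<subseteq> S" "g 0 \<in> carrier G" "g (Suc 0) \<in> carrier G"
    and PP: "P 0 \<inter> P (Suc 0) = {}"
    and Q: "\<And>j. j < n \<Longrightarrow> h j \<in> carrier G" "\<And>j. j < n \<Longrightarrow> Q j \<subseteq> S"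
    and PQ: "\<And>i j. i < 2 \<Longrightarrow> j < n \<Longrightarrow> P i \<inter> Q j = {}"
    using paradoxical_decompositionD(1-6)[OF dec] by simp_all
  define t where "t = g 0 \<otimes> inv (g (Suc 0))"
  have t: "t \<in> carrier G" using P by (simp add: t_def)
  have KG: "subgroup K G" using K(1) by (simp add: normal_imp_subgroup)
  obtain L :: nat where L: "0 < L" "t [^] L \<in> K"
    using finite_index_power_mem[OF KG K(2) t] by blast
  have tL: "t [^] L \<in> carrier G" using t by simp
  define T where "T = (\<lambda>j. inv (h j) \<otimes> t [^] L \<otimes> h j) ` {..<n}"
  have "finite T" by (simp add: T_def)
  moreover have "card T \<le> 3"
    using card_image_le[of "{..<n}" "\<lambda>j. inv (h j) \<otimes> t [^] L \<otimes> h j"] n by (simp add: T_def)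
  moreover have "T \<subseteq> K"
    using normal.inv_op_closed1[OF K(1) Q(1) L(2)] by (auto simp: T_def)
  ultimately have "\<exists>x\<in>S. \<forall>u\<in>T. \<phi> u x = x" by (rule fixed)
  then obtain x where x: "x \<in> S" "\<And>u. u \<in> T \<Longrightarrow> \<phi> u x = x" by blast
  obtain j y where j: "j < n" "y \<in> Q j" "\<phi> (h j) y = x"
    using pieces_cover(2)[OF dec' x(1)] by blast
  have y: "y \<in> S" using Q(2)[OF j(1)] j(2) by blast
  note hj = Q(1)[OF j(1)]
  have undo: "\<phi> (inv (h j)) x = y" using act_inv_act[OF hj y] j(3) by simp
  have "\<phi> (h j) (\<phi> (t [^] L) y) = \<phi> (inv (h j) \<otimes> t [^] L \<otimes> h j) x"
    using act_mult[OF m_closed[OF inv_closed[OF hj] tL] hj x(1)] act_mult[OF inv_closed[OF hj] tL x(1)] undo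
    by simp
  also have "\<dots> = \<phi> (h j) y" using x(2) j by (simp add: T_def)
  finally have "\<phi> (t [^] L) y = y" using act_inj[OF hj act_closed[OF tL y] y] by simp
  then have "y \<in> P 0 \<union> P (Suc 0)"
    using periodic_point_in_pieces[OF P(1,2) PP P(3,4) pieces_cover(1)[OF dec'] L(1) y]
    by (simp add: t_def)
  moreover have "P 0 \<inter> Q j = {}" "P (Suc 0) \<inter> Q j = {}" using PQ[OF _ j(1)] by auto
  ultimately show False using j(2) by blast
qed

text \<open>
  With at most five pieces, one of the two families has at most two.
\<close>

lemma tarski_number_ge_6:
  assumes "K \<lhd> G" "finite (rcosets K)"
    and "\<And>T. finite T \<Longrightarrow> card T \<le> 3 \<Longrightarrow> T \<subseteq> K \<Longrightarrow> \<exists>x\<in>S. \<forall>t\<in>T. \<phi> t x = x"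
    and "S \<noteq> {}"
  shows "6 \<le> tarski_number G S \<phi>"
proof -
  have small: False
    if dec: "paradoxical_decomposition G S \<phi> m n P Q g h" and "m \<le> n" "m + n \<le> 5" for m n P Q g h
  proof -
    have "0 < m" using dec by (simp add: paradoxical_decomposition_def)
    with that consider "m = 1" | "m = 2" "n \<le> 3" by linarith
    then show False
    proof cases
      case 1
      then show ?thesis using no_paradox_with_one_piece[OF _ assms(4)] dec by blast
    next
      case 2
      then show ?thesis using no_paradox_with_two_and_three_pieces[OF assms(1-3)] dec by blast
    qed
  qed
  have "enat 6 \<le> tarski_number G S \<phi>"
  proof (rule tarski_number_ge)
    fix m n P Q g h assume dec: "paradoxical_decomposition G S \<phi> m n P Q g h"
    show "6 \<le> m + n"
    proof (rule ccontr)
      assume "\<not> ?thesis"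
      then have "m \<le> n \<and> m + n \<le> 5 \<or> n \<le> m \<and> n + m \<le> 5" by linarith
      then show False
        using small[OF dec] small[OF paradoxical_decomposition_swap[OF dec]] by blast
    qed
  qed
  then show ?thesis by (simp add: numeral_eq_enat)
qed

lemma tarski_number_subgroup_ge:
  assumes K: "K \<subseteq> carrier G"
    and fixed: "\<And>T. finite T \<Longrightarrow> card T \<le> k \<Longrightarrow> T \<subseteq> K \<Longrightarrow> \<exists>x\<in>S. \<forall>t\<in>T. \<phi> t x = x"
  shows "enat k \<le> tarski_number (G\<lparr>carrier := K\<rparr>) S \<phi>"
proof (rule tarski_number_ge)
  fix m n P Q g h assume dec: "paradoxical_decomposition (G\<lparr>carrier := K\<rparr>) S \<phi> m n P Q g h"
  show "k \<le> m + n"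
  proof (rule ccontr)
    assume less: "\<not> ?thesis"
    define T where "T = g ` {..<m} \<union> h ` {..<n}"
    have "card T \<le> card (g ` {..<m}) + card (h ` {..<n})" unfolding T_def by (rule card_Un_le)
    also have "\<dots> \<le> m + n"
      using card_image_le[of "{..<m}" g] card_image_le[of "{..<n}" h] by simp
    finally have "card T \<le> k" using less by simp
    moreover have "T \<subseteq> K" using paradoxical_decompositionD(2,4)[OF dec] by (auto simp: T_def)
    moreover have "finite T" by (simp add: T_def)
    ultimately have "\<exists>x\<in>S. \<forall>t\<in>T. \<phi> t x = x" using fixed by metis
    then obtain x where "x \<in> S" "\<And>t. t \<in> T \<Longrightarrow> \<phi> t x = x" by blast
    then show False
      using no_paradox_with_common_fixed_point[OF K dec, of x] by (auto simp: T_def)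
  qed
qed

end

context free_group_action
begin

text \<open>
  \<open>A\<close> are the points whose first copies, and \<open>C\<close> the points whose second copies, are to be matched.
  The moves by \<open>a\<close>, \<open>b\<close> and \<open>c\<close> contribute \<open>card (A \<union> C)\<close>, \<open>card A\<close> and \<open>card C\<close> different edges
  among the candidates.
\<close>

lemma sparse_hall_condition:
  assumes sp: "sparse \<phi> B S" and abc: "a \<in> B" "b \<in> B" "c \<in> B" "a \<noteq> b" "a \<noteq> c" "b \<noteq> c"
    and AC: "finite A" "finite C" "A \<subseteq> S" "C \<subseteq> S"
  shows "card A + card C
    \<le> card (A \<union> C \<union> \<phi> a ` (A \<union> C) \<union> \<phi> b ` A \<union> \<phi> c ` C)" (is "_ \<le> card ?Z")
proof -
  have Z: "finite ?Z" "?Z \<subseteq> S"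
    using AC act_closed basis_closed abc by auto
  have "(A \<union> C) \<times> {a} \<union> A \<times> {b} \<union> C \<times> {c} \<subseteq> edges ?Z"
    using abc by (auto simp: inner_edges_def)
  then have "card ((A \<union> C) \<times> {a} \<union> A \<times> {b} \<union> C \<times> {c}) \<le> card (edges ?Z)"
    using finite_inner_edges[OF Z(1) finite_basis] by (rule card_mono[rotated])
  moreover have "card ((A \<union> C) \<times> {a} \<union> A \<times> {b} \<union> C \<times> {c}) = card (A \<union> C) + card A + card C"
  proof -
    have "card ((A \<union> C) \<times> {a} \<union> A \<times> {b} \<union> C \<times> {c})
        = card ((A \<union> C) \<times> {a} \<union> A \<times> {b}) + card (C \<times> {c})"
      using AC abc by (intro card_Un_disjoint) auto
    also have "card ((A \<union> C) \<times> {a} \<union> A \<times> {b}) = card ((A \<union> C) \<times> {a}) + card (A \<times> {b})"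
      using AC abc by (intro card_Un_disjoint) auto
    finally show ?thesis by (simp add: card_cartesian_product)
  qed
  moreover have "2 * card (edges ?Z) \<le> 3 * card ?Z"
    using sp Z by (simp add: sparse_def)
  moreover have "card A \<le> card (A \<union> C)" "card C \<le> card (A \<union> C)"
    using AC by (auto intro: card_mono)
  ultimately show ?thesis by linarith
qed

text \<open>
  The marriage theorem gives an injective choice \<open>f\<close> of targets for both copies of all points. The
  pieces consist of the targets that are reached by the same move, and are translated by its inverse.
\<close>

lemma sparse_paradoxical:
  assumes sp: "sparse \<phi> B S" and abc: "a \<in> B" "b \<in> B" "c \<in> B" "a \<noteq> b" "a \<noteq> c" "b \<noteq> c"
  shows "\<exists>P Q g h. paradoxical_decomposition G S \<phi> 3 3 P Q g h"
proof -
  define move where "move e i = (if i = 0 then \<one> else if i = 1 then a else if e then b else c)"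
    for e :: bool and i :: nat
  define N where "N = (\<lambda>(x, e). (\<lambda>i. \<phi> (move e i) x) ` {..<3})"
  have move: "move e i \<in> carrier G" for e i
    using basis_closed abc by (simp add: move_def)
  have three: "{..<3} = {0, 1, 2 :: nat}" by auto
  have "\<exists>f. inj_on f (S \<times> UNIV) \<and> (\<forall>q\<in>S \<times> UNIV. f q \<in> N q)"
  proof (rule infinite_marriage)
    show "finite (N q)" for q by (cases q) (simp add: N_def)
    show "card J \<le> card (\<Union>q\<in>J. N q)" if J: "finite J" "J \<subseteq> S \<times> UNIV" for J
    proof -
      define A where "A = {x. (x, True) \<in> J}"
      define C where "C = {x. (x, False) \<in> J}"
      have JAC: "J = A \<times> {True} \<union> C \<times> {False}"
        by (auto simp: A_def C_def) (metis (full_types))+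
      have "A = fst ` (J \<inter> UNIV \<times> {True})" "C = fst ` (J \<inter> UNIV \<times> {False})"
        by (force simp: A_def C_def)+
      then have AC: "finite A" "finite C" using J(1) by simp_all
      have sub: "A \<subseteq> S" "C \<subseteq> S" using J(2) by (auto simp: A_def C_def)
      have cJ: "card J = card A + card C"
        unfolding JAC using AC by (subst card_Un_disjoint) (auto simp: card_cartesian_product)
      have one: "\<phi> \<one> x = x" if "x \<in> A \<or> x \<in> C" for x
        using that sub act_one by blast
      have NA: "N (x, True) = {x, \<phi> a x, \<phi> b x}" if "x \<in> A" for x
        using one that by (simp add: N_def three move_def)
      have NC: "N (x, False) = {x, \<phi> a x, \<phi> c x}" if "x \<in> C" for x
        using one that by (simp add: N_def three move_def)
      have "(\<Union>q\<in>J. N q) = (\<Union>x\<in>A. N (x, True)) \<union> (\<Union>x\<in>C. N (x, False))"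
        by (subst JAC) auto
      also have "\<dots> = (\<Union>x\<in>A. {x, \<phi> a x, \<phi> b x}) \<union> (\<Union>x\<in>C. {x, \<phi> a x, \<phi> c x})"
        using NA NC by (simp cong: SUP_cong)
      also have "\<dots> = A \<union> C \<union> \<phi> a ` (A \<union> C) \<union> \<phi> b ` A \<union> \<phi> c ` C" by auto
      finally show ?thesis
        using sparse_hall_condition[OF sp abc AC sub] cJ by simp
    qed
  qed
  then obtain f where inj: "inj_on f (S \<times> UNIV)" and fN: "\<And>x e. x \<in> S \<Longrightarrow> f (x, e) \<in> N (x, e)"
    by blast
  have "\<exists>i<3. f (x, e) = \<phi> (move e i) x" if "x \<in> S" for x e
    using fN[OF that, of e] by (auto simp: N_def)
  then obtain idx where idx: "\<And>x e. x \<in> S \<Longrightarrow> idx x e < (3 :: nat)"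
    and f: "\<And>x e. x \<in> S \<Longrightarrow> f (x, e) = \<phi> (move e (idx x e)) x"
    by metis
  define R where "R e i = {f (x, e) | x. x \<in> S \<and> idx x e = i}" for e i
  have sub: "R e i \<subseteq> S" for e i
    using f act_closed[OF move] by (auto simp: R_def)
  have disj: "R e i \<inter> R e' i' = {}" if "(e, i) \<noteq> (e', i')" for e i e' i'
  proof (rule ccontr)
    assume "\<not> ?thesis"
    then obtain x x' where x: "x \<in> S" "x' \<in> S" "idx x e = i" "idx x' e' = i'" "f (x, e) = f (x', e')"
      by (auto simp: R_def)
    then have "(x, e) = (x', e')" using inj by (auto dest: inj_onD)
    then show False using x that by auto
  qed
  have image: "\<phi> (inv (move e i)) ` R e i = {x \<in> S. idx x e = i}" for e i
  proof -
    have "\<phi> (inv (move e i)) (f (x, e)) = x" if "x \<in> S" "idx x e = i" for x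
      using f that act_inv_act[OF move] by auto
    then show ?thesis by (force simp: R_def)
  qed
  have cover: "S = (\<Union>i<3. \<phi> (inv (move e i)) ` R e i)" for e
    unfolding image using idx by auto
  have "paradoxical_decomposition G S \<phi> 3 3 (R True) (R False)
      (\<lambda>i. inv (move True i)) (\<lambda>i. inv (move False i))"
    unfolding paradoxical_decomposition_def disjoint_family_on_def
    using sub disj move cover[of True] cover[of False] by simp
  then show ?thesis by blast
qed

end

theorem theorem2:
  fixes F :: "('a, 'c) monoid_scheme"
  assumes "free_group_of_rank F 3"
  shows "\<exists>(\<Omega> :: nat set) (\<phi> :: 'a \<Rightarrow> nat \<Rightarrow> nat).
           faithful_action (opposite F) \<Omega> \<phi> \<and>
           transitive_action (opposite F) \<Omega> \<phi> \<and>
           tarski_number F \<Omega> \<phi> = 6 \<and>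
           (\<forall>N :: nat. \<exists>F\<^sub>0. subgroup F\<^sub>0 F \<and> finite (rcosets\<^bsub>F\<^esub> F\<^sub>0) \<and>
              tarski_number (F\<lparr>carrier := F\<^sub>0\<rparr>) \<Omega> \<phi> \<ge> enat N)"
proof -
  obtain B where F: "group F" "free_basis F B" "finite B" "card B = 3"
    using assms by (auto simp: free_group_of_rank_def)
  interpret finite_free_basis F B
    using F by (simp add: finite_free_basis_def finite_free_basis_axioms_def)
  have "\<exists>K. K \<lhd> F \<and> finite (rcosets\<^bsub>F\<^esub> K) \<and>
     (\<forall>w\<in>reduced_words B. length w \<le> 2 * k + 2 \<longrightarrow> word_value F w \<in> K \<longrightarrow> w = [])" for k
    by (rule residually_finite)
  then obtain K where K: "\<And>k. K k \<lhd> F" "\<And>k. finite (rcosets\<^bsub>F\<^esub> (K k))"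
    and short: "\<And>k w. w \<in> reduced_words B \<Longrightarrow> length w \<le> 2 * k + 2 \<Longrightarrow> word_value F w \<in> K k \<Longrightarrow> w = []"
    by metis
  have KF: "subgroup (K k) F" for k using K(1) normal_imp_subgroup by blast
  have rank: "2 \<le> card B" using F(4) by simp
  have "\<exists>(\<Omega> :: nat set) \<phi>. right_action F \<Omega> \<phi> \<and> \<Omega> \<noteq> {} \<and> sparse \<phi> B \<Omega> \<and>
     (\<forall>x\<in>\<Omega>. \<forall>y\<in>\<Omega>. \<exists>g\<in>carrier F. \<phi> g x = y) \<and>
     inj_on \<phi> (carrier F) \<and>
     (\<forall>k T. finite T \<longrightarrow> card T \<le> k \<longrightarrow> T \<subseteq> K k \<longrightarrow> (\<exists>x\<in>\<Omega>. \<forall>t\<in>T. \<phi> t x = x))"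
    by (rule sparse_action_with_fixed_points[OF rank K(1)]) (rule short)
  then obtain \<Omega> :: "nat set" and \<phi> where act: "right_action F \<Omega> \<phi>" and ne: "\<Omega> \<noteq> {}"
    and sp: "sparse \<phi> B \<Omega>" and trans: "\<forall>x\<in>\<Omega>. \<forall>y\<in>\<Omega>. \<exists>g\<in>carrier F. \<phi> g x = y"
    and faithful: "inj_on \<phi> (carrier F)"
    and all_fixed: "\<forall>k T. finite T \<longrightarrow> card T \<le> k \<longrightarrow> T \<subseteq> K k \<longrightarrow> (\<exists>x\<in>\<Omega>. \<forall>t\<in>T. \<phi> t x = x)"
    by (elim exE conjE) (rule that)
  have fixed: "\<exists>x\<in>\<Omega>. \<forall>t\<in>T. \<phi> t x = x"
    if "finite T" "card T \<le> k" "T \<subseteq> K k" for k T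
    using all_fixed that by (elim allE impE)
  interpret right_action F \<Omega> \<phi> by (rule act)
  interpret free_group_action F B \<Omega> \<phi> ..
  obtain a b c where abc: "B = {a, b, c}" "a \<noteq> b" "a \<noteq> c" "b \<noteq> c"
    using F(4) by (auto simp: card_3_iff)
  have "tarski_number F \<Omega> \<phi> \<le> 6"
    using sparse_paradoxical[OF sp, of a b c] abc tarski_number_le[of F \<Omega> \<phi> 3 3]
    by (auto simp: numeral_eq_enat)
  moreover have "6 \<le> tarski_number F \<Omega> \<phi>"
    by (rule tarski_number_ge_6[OF K(1)[of 3] K(2)[of 3] _ ne]) (rule fixed)
  ultimately have "tarski_number F \<Omega> \<phi> = 6" by (rule antisym)
  moreover have "enat N \<le> tarski_number (F\<lparr>carrier := K N\<rparr>) \<Omega> \<phi>" for N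
    by (rule tarski_number_subgroup_ge[OF subgroup.subset[OF KF]]) (rule fixed)
  moreover have "faithful_action (opposite F) \<Omega> \<phi>"
    using action faithful by (simp add: faithful_action_def faithful_action_axioms_def)
  moreover have "transitive_action (opposite F) \<Omega> \<phi>"
    using action trans by (simp add: transitive_action_def transitive_action_axioms_def)
  ultimately show ?thesis using KF K(2) by blast
qed

end
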